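(* Let $K$ be a field, let $n,d\ge2$ with $d\ne3$, let $\mathbf a=(0,\dots,0,1,d-1)$, $\Gamma=V(n,d)\setminus\{\mathbf a\}$, $S=K[x_\alpha:\alpha\in\Gamma]$ and let $I(\Gamma)$ be the kernel of $S\to K[\Gamma]$, $x_\alpha\mapsto t^\alpha$. Let $\prec$ be the graded reverse lexicographic order on $S$ with respect to the ordering of variables $x_\alpha>x_\beta$ iff $\alpha<\beta$ lexicographically. For each pair $\alpha\le\beta$ in $\Gamma$ such that the chain $(\alpha,\beta)$ is not minimal, let $(\gamma,\delta)$ be the minimal chain with $\gamma+\delta=\alpha+\beta$. Then the set $\mathcal G$ of all such binomials $x_\alpha x_\beta-x_\gamma x_\delta$ is a Gröbner basis of $I(\Gamma)$ with respect to $\prec$. Consequently $K[\Gamma]$ is Koszul.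
   Context: $V(n,d)=\{\mathbf b\in\mathbb N^n:\sum_i b_i=d\}$, ordered lexicographically: $b<c$ iff the first nonzero coordinate of $c-b$ is positive. $K[\Gamma]$ is the $K$-subalgebra of $K[t_1,\dots,t_n]$ generated by $t^\alpha$, $\alpha\in\Gamma$, standard graded. A chain of length $k$ is a tuple $(u^1,\dots,u^k)\in V(n,d)^k$; its $\mathbf a$-degree is the number of $j$ with $u^j=\mathbf a$. Chains of length $k$ with equal sum are compared by $\mathbf a$-degree first (smaller is smaller), then lexicographically as tuples (comparing first entries first, using the order on $V(n,d)$). A chain is minimal if it is smallest among all chains in $V(n,d)^k$ with the same sum. (The minimal chain $(\gamma,\delta)$ above has $\mathbf a$-degree $0$, so $\gamma,\delta\in\Gamma$.) Koszul means the residue field $K$ has a linear free resolution over $K[\Gamma]$. *)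

theory Defs
  imports Main "HOL-Library.Poly_Mapping"
begin

text \<open>Exponent vectors in N^n are finitely supported maps nat =>0 nat with Poly_Mapping.keys in {..<n}
 (coordinate i is index i-1 of the paper, i.e. indices 0..n-1).\<close>

type_synonym expv = "nat \<Rightarrow>\<^sub>0 nat"
text \<open>Monomials of S: exponents indexed by the variables x_alpha (alpha an exponent vector).\<close>
type_synonym smon = "expv \<Rightarrow>\<^sub>0 nat"
type_synonym 'k spoly = "smon \<Rightarrow>\<^sub>0 'k"
type_synonym 'k tpoly = "expv \<Rightarrow>\<^sub>0 'k"

definition V :: "nat \<Rightarrow> nat \<Rightarrow> expv set" where
  "V n d = {b. Poly_Mapping.keys b \<subseteq> {..<n} \<and> (\<Sum>i<n. Poly_Mapping.lookup b i) = d}"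

definition lex_less :: "expv \<Rightarrow> expv \<Rightarrow> bool" where
  "lex_less b c \<longleftrightarrow> (\<exists>k. (\<forall>i<k. Poly_Mapping.lookup b i = Poly_Mapping.lookup c i) \<and> Poly_Mapping.lookup b k < Poly_Mapping.lookup c k)"

definition lex_le :: "expv \<Rightarrow> expv \<Rightarrow> bool" where
  "lex_le b c \<longleftrightarrow> b = c \<or> lex_less b c"

definition avec :: "nat \<Rightarrow> nat \<Rightarrow> expv" where
  "avec n d = Poly_Mapping.single (n - 2) 1 + Poly_Mapping.single (n - 1) (d - 1)"

definition Gamma :: "nat \<Rightarrow> nat \<Rightarrow> expv set" where
  "Gamma n d = V n d - {avec n d}"

text \<open>A chain of length k is a list of length k of elements of V(n,d).\<close>
definition adeg :: "expv \<Rightarrow> expv list \<Rightarrow> nat" where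
  "adeg a c = length (filter (\<lambda>u. u = a) c)"

definition tuple_lex_less :: "expv list \<Rightarrow> expv list \<Rightarrow> bool" where
  "tuple_lex_less c c' \<longleftrightarrow> length c = length c' \<and>
     (\<exists>k<length c. take k c = take k c' \<and> lex_less (c ! k) (c' ! k))"

definition chain_less :: "expv \<Rightarrow> expv list \<Rightarrow> expv list \<Rightarrow> bool" where
  "chain_less a c c' \<longleftrightarrow> adeg a c < adeg a c' \<or> (adeg a c = adeg a c' \<and> tuple_lex_less c c')"

definition minimal_chain :: "nat \<Rightarrow> nat \<Rightarrow> expv list \<Rightarrow> bool" where
  "minimal_chain n d c \<longleftrightarrow> set c \<subseteq> V n d \<and>
     \<not> (\<exists>c'. length c' = length c \<and> set c' \<subseteq> V n d \<and> sum_list c' = sum_list c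
            \<and> chain_less (avec n d) c' c)"

definition var :: "expv \<Rightarrow> 'k::field spoly" where
  "var \<alpha> = Poly_Mapping.single (Poly_Mapping.single \<alpha> 1) 1"

definition Sring :: "expv set \<Rightarrow> 'k::field spoly set" where
  "Sring G = {f. \<forall>m\<in>Poly_Mapping.keys f. Poly_Mapping.keys m \<subseteq> G}"

text \<open>Image exponent of a monomial prod x_alpha^(m alpha) under x_alpha -> t^alpha.\<close>
definition mon_img :: "smon \<Rightarrow> expv" where
  "mon_img m = (\<Sum>\<alpha>\<in>Poly_Mapping.keys m. Poly_Mapping.map (\<lambda>x. Poly_Mapping.lookup m \<alpha> * x) \<alpha>)"

definition toric_map :: "'k::field spoly \<Rightarrow> 'k tpoly" where
  "toric_map f = (\<Sum>m\<in>Poly_Mapping.keys f. Poly_Mapping.single (mon_img m) (Poly_Mapping.lookup f m))"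

definition toric_ideal :: "expv set \<Rightarrow> 'k::field spoly set" where
  "toric_ideal G = {f \<in> Sring G. toric_map f = 0}"

definition ideal_gen :: "expv set \<Rightarrow> 'k::field spoly set \<Rightarrow> 'k spoly set" where
  "ideal_gen G A = {f. \<exists>F c. finite F \<and> F \<subseteq> A \<and> (\<forall>g\<in>F. c g \<in> Sring G)
                       \<and> f = (\<Sum>g\<in>F. c g * g)}"

definition mdeg :: "smon \<Rightarrow> nat" where
  "mdeg m = (\<Sum>\<alpha>\<in>Poly_Mapping.keys m. Poly_Mapping.lookup m \<alpha>)"

text \<open>grevlex_less m m' means m is strictly smaller than m': lower degree, or same degree and
 in the smallest variable (w.r.t. the variable order) where they differ, m has the larger exponent.
 A variable x_gamma is smaller than x_beta iff beta <lex gamma.\<close>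
definition grevlex_less :: "smon \<Rightarrow> smon \<Rightarrow> bool" where
  "grevlex_less m m' \<longleftrightarrow> mdeg m < mdeg m' \<or>
     (mdeg m = mdeg m' \<and> (\<exists>\<beta>. Poly_Mapping.lookup m' \<beta> < Poly_Mapping.lookup m \<beta> \<and>
         (\<forall>\<gamma>. lex_less \<beta> \<gamma> \<longrightarrow> Poly_Mapping.lookup m \<gamma> = Poly_Mapping.lookup m' \<gamma>)))"

definition lead_mon :: "'k::field spoly \<Rightarrow> smon" where
  "lead_mon f = (THE m. m \<in> Poly_Mapping.keys f \<and> (\<forall>m'\<in>Poly_Mapping.keys f. m' \<noteq> m \<longrightarrow> grevlex_less m' m))"

definition mono_poly :: "smon \<Rightarrow> 'k::field spoly" where
  "mono_poly m = Poly_Mapping.single m 1"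

definition initial_ideal :: "expv set \<Rightarrow> 'k::field spoly set \<Rightarrow> 'k spoly set" where
  "initial_ideal G J = ideal_gen G ((\<lambda>f. mono_poly (lead_mon f)) ` (J - {0}))"

definition groebner_basis :: "expv set \<Rightarrow> 'k::field spoly set \<Rightarrow> 'k spoly set \<Rightarrow> bool" where
  "groebner_basis G B J \<longleftrightarrow> B \<subseteq> J \<and> initial_ideal G J = initial_ideal G B"

definition semigrp :: "expv set \<Rightarrow> expv set" where
  "semigrp G = {sum_list us | us. set us \<subseteq> G}"

text \<open>K[Gamma] as a subalgebra of K[t]: spanned by t^u, u in the monoid generated by Gamma;
 its degree-1 component is spanned by t^alpha, alpha in Gamma.\<close>
definition semigroup_ring :: "expv set \<Rightarrow> 'k::field tpoly set" where
  "semigroup_ring G = {p. Poly_Mapping.keys p \<subseteq> semigrp G}"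

definition semigroup_ring_deg1 :: "expv set \<Rightarrow> 'k::field tpoly set" where
  "semigroup_ring_deg1 G = {p. Poly_Mapping.keys p \<subseteq> G}"

definition free_mod :: "expv set \<Rightarrow> nat \<Rightarrow> (nat \<Rightarrow> 'k::field tpoly) set" where
  "free_mod G b = {v. (\<forall>j<b. v j \<in> semigroup_ring G) \<and> (\<forall>j\<ge>b. v j = 0)}"

definition mat_app :: "nat \<Rightarrow> nat \<Rightarrow> (nat \<Rightarrow> nat \<Rightarrow> 'k::field tpoly) \<Rightarrow> (nat \<Rightarrow> 'k tpoly) \<Rightarrow> nat \<Rightarrow> 'k tpoly" where
  "mat_app r c M v = (\<lambda>i. if i < r then (\<Sum>j<c. M i j * v j) else 0)"

text \<open>K has a linear free resolution over R = K[Gamma]: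
  ... -> R(-2)^{b_2} -> R(-1)^{b_1} -> R -> K -> 0 exact, with all differentials
  d_i (i >= 1) given by matrices of linear forms (entries in R_1), and R -> K the augmentation
  (constant term).\<close>
definition koszul :: "expv set \<Rightarrow> 'k::field itself \<Rightarrow> bool" where
  "koszul G (_ :: 'k itself) \<longleftrightarrow>
    (\<exists>(b :: nat \<Rightarrow> nat) (M :: nat \<Rightarrow> nat \<Rightarrow> nat \<Rightarrow> 'k tpoly).
       b 0 = 1 \<and>
       (\<forall>i\<ge>1. \<forall>r<b (i - 1). \<forall>c<b i. M i r c \<in> semigroup_ring_deg1 G) \<and>
       {v \<in> free_mod G (b 0). Poly_Mapping.lookup (v 0) 0 = 0} = mat_app (b 0) (b 1) (M 1) ` free_mod G (b 1) \<and>
       (\<forall>i\<ge>1. {v \<in> free_mod G (b i). mat_app (b (i - 1)) (b i) (M i) v = (\<lambda>_. 0)}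
               = mat_app (b i) (b (i + 1)) (M (i + 1)) ` free_mod G (b (i + 1))))"

end

theory Submission
  imports Defs "HOL-Library.List_Lexorder"
begin

text \<open>
  Call a pair \<open>(u, v)\<close> of \<open>\<Gamma>\<close> standard if it is a minimal chain, and a word standard if all its consecutive
  pairs are. Everything follows from one fact: a standard word is determined by its sum.
  It makes the standard word the lexicographically least word with a given sum, and the sorted word
  of the grevlex-least monomial in a fibre of \<open>S \<rightarrow> K[\<Gamma>]\<close>; hence a monomial whose sorted word is
  standard is never leading for \<open>I(\<Gamma>)\<close>, which is the Groebner basis property.

  For Koszulness, \<open>K[\<Gamma>]\<close> is PBW for standard words, and Anick's resolution is linear: the generators
  in homological degree \<open>i\<close> are the words of length \<open>i\<close> all of whose consecutive pairs are nonstandard,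
  and the differential sends such a word \<open>c\<close> to its first letter times its tail plus
  lexicographically smaller terms. In a fixed multidegree \<open>s\<close> a basis element \<open>c\<close> is identified with
  the word obtained by prefixing \<open>c\<close> with the standard word of \<open>s - \<Sum>c\<close>; triangularity with respect to
  these words gives exactness, and exactness in one degree produces the next differential.

  To see that standard words are determined by their sums, let \<open>t\<^sub>n\<close>, \<open>t\<^sub>n\<^sub>-\<^sub>1\<close> be the last variables.
  Without the pinching, a standard word fills its letters greedily from the last variable downwards.
  If the greedy letter of a pair is \<open>a\<close>, the standard pair is instead \<open>(t\<^sub>n\<^sub>-\<^sub>1\<^sup>2 t\<^sub>n\<^bsup>d-2\<^esup>, t\<^sub>n w)\<close> or
  \<open>(t\<^sub>j t\<^sub>n\<^bsup>d-1\<^esup>, t\<^sub>n\<^sub>-\<^sub>1 w)\<close>. For \<open>d \<noteq> 3\<close> this relation is transitive (for \<open>d = 3\<close> the first kind of pair can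
  be repeated), so that the sum of a standard word determines its first letter.
\<close>

section \<open>Standard words\<close>

lemma append_less_append_left_iff [simp]:
  fixes x y z :: "'a::order list"
  shows "z @ x < z @ y \<longleftrightarrow> x < y"
  by (induction z) auto

lemma append_le_append_left_iff [simp]:
  fixes x y z :: "'a::order list"
  shows "z @ x \<le> z @ y \<longleftrightarrow> x \<le> y"
  by (induction z) auto

lemma append_less_append_right:
  fixes x y :: "'a::order list"
  assumes "x < y" "length x = length y"
  shows "x @ z < y @ z'"
  using assms
proof (induction x arbitrary: y)
  case (Cons a x)
  then show ?case by (cases y) auto
qed auto

text \<open>Comparing first letters is enough, since the sum then fixes the second one. For letters
  of \<open>Gamma n d\<close> this is minimality of the chain \<open>[u, v]\<close>, by
  \<open>minimal_chain_iff_std_pair\<close>.\<close>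

definition std_pair :: "expv set \<Rightarrow> expv \<Rightarrow> expv \<Rightarrow> bool" where
  "std_pair G u v \<longleftrightarrow> u \<in> G \<and> v \<in> G \<and> (\<forall>\<gamma>\<in>G. \<forall>\<delta>\<in>G. \<gamma> + \<delta> = u + v \<longrightarrow> u \<le> \<gamma>)"

definition std_word :: "expv set \<Rightarrow> expv list \<Rightarrow> bool" where
  "std_word G l \<longleftrightarrow> set l \<subseteq> G \<and> successively (std_pair G) l"

lemma std_pair_le: "std_pair G u v \<Longrightarrow> u \<le> v"
  by (metis std_pair_def add.commute)

text \<open>The interface between combinatorics and algebra: \<open>length_eq\<close> grades the
  semigroup by word length, and \<open>std_word_unique\<close> is the PBW property. Koszulness and
  the Groebner basis are both derived from these assumptions alone.\<close>

locale pbw_set =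
  fixes G :: "expv set"
  assumes finite_G: "finite G"
    and length_eq: "\<lbrakk>set l \<subseteq> G; set l' \<subseteq> G; sum_list l = sum_list l'\<rbrakk> \<Longrightarrow> length l = length l'"
    and std_word_unique: "\<lbrakk>std_word G l; std_word G l'; sum_list l = sum_list l'\<rbrakk> \<Longrightarrow> l = l'"
begin

definition words :: "expv \<Rightarrow> expv list set" where
  "words s = {l. set l \<subseteq> G \<and> sum_list l = s}"

text \<open>Least for the lexicographic order of lists. The value is meaningful only for
  \<open>s\<close> in \<open>semigrp G\<close>, where the set of words is nonempty; it is finite
  because words of equal sum have equal length.\<close>

definition nf :: "expv \<Rightarrow> expv list" where
  "nf s = Min (words s)"

lemma semigrp_iff: "s \<in> semigrp G \<longleftrightarrow> words s \<noteq> {}"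
  by (auto simp: semigrp_def words_def)

lemma semigrp_0 [simp]: "0 \<in> semigrp G"
  unfolding semigrp_def by (auto intro: exI[of _ "[]"])

lemma semigrp_base: "a \<in> G \<Longrightarrow> a \<in> semigrp G"
  unfolding semigrp_def by (auto intro: exI[of _ "[a]"])

lemma semigrp_add: "r \<in> semigrp G \<Longrightarrow> r' \<in> semigrp G \<Longrightarrow> r + r' \<in> semigrp G"
  unfolding semigrp_def
proof clarsimp
  fix us us' assume "set us \<subseteq> G" "set us' \<subseteq> G"
  then show "\<exists>vs. sum_list us + sum_list us' = sum_list vs \<and> set vs \<subseteq> G"
    by (intro exI[of _ "us @ us'"]) auto
qed

lemma finite_words: "finite (words s)"
proof (cases "words s = {}")
  case False
  then obtain l where l: "l \<in> words s" by auto
  have "words s \<subseteq> {l'. set l' \<subseteq> G \<and> length l' = length l}"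
  proof
    fix l' assume "l' \<in> words s"
    then have "set l' \<subseteq> G" "set l \<subseteq> G" "sum_list l' = sum_list l"
      using l by (simp_all add: words_def)
    then show "l' \<in> {l'. set l' \<subseteq> G \<and> length l' = length l}"
      using length_eq by blast
  qed
  then show ?thesis
    by (rule finite_subset[OF _ finite_lists_length_eq[OF finite_G]])
qed simp

lemma nf_in_words: "s \<in> semigrp G \<Longrightarrow> nf s \<in> words s"
  unfolding nf_def semigrp_iff by (rule Min_in[OF finite_words])

lemma nf_set: "s \<in> semigrp G \<Longrightarrow> set (nf s) \<subseteq> G"
  and nf_sum: "s \<in> semigrp G \<Longrightarrow> sum_list (nf s) = s"
  using nf_in_words by (auto simp: words_def)

lemma nf_le: "set l \<subseteq> G \<Longrightarrow> nf (sum_list l) \<le> l"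
  unfolding nf_def by (rule Min_le[OF finite_words]) (simp add: words_def)

lemma sum_list_in_semigrp: "set l \<subseteq> G \<Longrightarrow> sum_list l \<in> semigrp G"
  by (auto simp: semigrp_def)

lemma length_nf: "set l \<subseteq> G \<Longrightarrow> length (nf (sum_list l)) = length l"
  by (meson length_eq nf_set nf_sum sum_list_in_semigrp)

text \<open>Replacing a nonstandard consecutive pair by a factorization of the same sum with a
  smaller first letter would give a lexicographically smaller word.\<close>

lemma nf_std:
  assumes "s \<in> semigrp G"
  shows "std_word G (nf s)"
proof -
  have "std_pair G (nf s ! i) (nf s ! Suc i)" if i: "Suc i < length (nf s)" for i
  proof (rule ccontr)
    let ?l = "nf s"
    assume "\<not> std_pair G (?l ! i) (?l ! Suc i)"
    moreover have "?l ! i \<in> G" "?l ! Suc i \<in> G"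
      using nf_set[OF assms] i by (auto simp: subset_iff)
    ultimately obtain g h where gh: "g \<in> G" "h \<in> G" "g + h = ?l ! i + ?l ! Suc i" "g < ?l ! i"
      by (auto simp: std_pair_def not_le)
    have dec: "?l = take i ?l @ ?l ! i # ?l ! Suc i # drop (Suc (Suc i)) ?l"
      using i by (simp add: Cons_nth_drop_Suc)
    define l' where "l' = take i ?l @ g # h # drop (Suc (Suc i)) ?l"
    have "set l' \<subseteq> G"
      using nf_set[OF assms] gh
      by (auto simp: l'_def dest!: in_set_takeD in_set_dropD)
    moreover have "sum_list ?l = sum_list l'"
    proof -
      have "sum_list ?l = sum_list (take i ?l) + (?l ! i + ?l ! Suc i) + sum_list (drop (Suc (Suc i)) ?l)"
        by (subst dec) (simp add: add.assoc)
      also have "\<dots> = sum_list l'"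
        by (simp add: l'_def add.assoc flip: gh(3))
      finally show ?thesis .
    qed
    ultimately have "nf s \<le> l'"
      using nf_le[of l'] nf_sum[OF assms] by simp
    moreover have "l' < ?l"
      by (subst dec) (simp add: l'_def gh)
    ultimately show False by simp
  qed
  then show ?thesis
    using nf_set[OF assms] by (simp add: std_word_def successively_conv_nth)
qed

text \<open>Here uniqueness enters: a word is in normal form as soon as its consecutive pairs are
  standard.\<close>

lemma nf_std_word:
  assumes "std_word G l"
  shows "nf (sum_list l) = l"
proof (rule std_word_unique)
  have "sum_list l \<in> semigrp G"
    using assms by (simp add: std_word_def sum_list_in_semigrp)
  then show "std_word G (nf (sum_list l))" "sum_list (nf (sum_list l)) = sum_list l"
    by (simp_all add: nf_std nf_sum)
qed (use assms in auto)

lemma nf_0 [simp]: "nf 0 = []"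
  using nf_std_word[of "[]"] by (simp add: std_word_def)

lemma nf_single: "a \<in> G \<Longrightarrow> nf a = [a]"
  using nf_std_word[of "[a]"] by (simp add: std_word_def)

lemma nf_eq_Nil_iff: "s \<in> semigrp G \<Longrightarrow> nf s = [] \<longleftrightarrow> s = 0"
  using nf_sum by fastforce

lemma length_nf_add:
  assumes "r \<in> semigrp G" "a \<in> G"
  shows "length (nf (r + a)) = Suc (length (nf r))"
  using length_nf[of "nf r @ [a]"] assms nf_set nf_sum by simp

lemma nf_add_le:
  assumes "r \<in> semigrp G" "a \<in> G"
  shows "nf (r + a) \<le> nf r @ [a]"
  using nf_le[of "nf r @ [a]"] assms nf_set nf_sum by simp

section \<open>The resolution in a fixed multidegree\<close>

text \<open>These are Anick's chains, not the tuples compared in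
  \<open>minimal_chain\<close>.\<close>

definition chains :: "nat \<Rightarrow> expv list set" where
  "chains i = {c. set c \<subseteq> G \<and> length c = i \<and> successively (\<lambda>u v. \<not> std_pair G u v) c}"

text \<open>Indexes the \<open>K\<close>-basis of the multidegree \<open>s\<close> part of the free
  module on \<open>chains i\<close>: \<open>c\<close> stands for \<open>t^r\<close> times the
  generator of \<open>c\<close>, where \<open>r + sum_list c = s\<close>.\<close>

definition chains_at :: "nat \<Rightarrow> expv \<Rightarrow> expv list set" where
  "chains_at i s = {c \<in> chains i. \<exists>r\<in>semigrp G. s = r + sum_list c}"

definition full_word :: "expv \<Rightarrow> expv list \<Rightarrow> expv list" where
  "full_word s c = nf (s - sum_list c) @ c"

text \<open>Deleting the first letter matches the reduced chains of length \<open>i + 1\<close> with the nonreduced ones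
  of length \<open>i\<close> without changing \<open>full_word\<close>; this matching makes the differentials triangular.\<close>

definition reduced :: "expv \<Rightarrow> expv list \<Rightarrow> bool" where
  "reduced s c \<longleftrightarrow> nf (s - sum_list c) = [] \<or>
     (c \<noteq> [] \<and> std_pair G (last (nf (s - sum_list c))) (hd c))"

text \<open>\<open>m c' c\<close> is the scalar in row \<open>c'\<close> and column \<open>c\<close>
  of a differential; the monomial next to it has exponent \<open>sum_list c - sum_list c'\<close>.
  Asking this exponent to lie in \<open>G\<close> makes the entry linear, and
  \<open>a # c' < c\<close> makes \<open>tl c\<close> the leading row.\<close>

definition triangular :: "nat \<Rightarrow> (expv list \<Rightarrow> expv list \<Rightarrow> 'k::field) \<Rightarrow> bool" where
  "triangular i m \<longleftrightarrow> (\<forall>c\<in>chains (Suc i). m (tl c) c = 1 \<and>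
     (\<forall>c'\<in>chains i. c' \<noteq> tl c \<longrightarrow> m c' c \<noteq> 0 \<longrightarrow>
        (\<exists>a\<in>G. a + sum_list c' = sum_list c \<and> a # c' < c)))"

text \<open>The differential in one multidegree. The multidegree fixes all monomials, so only
  scalars remain, and the same \<open>m\<close> serves every multidegree.\<close>

definition bd :: "nat \<Rightarrow> (expv list \<Rightarrow> expv list \<Rightarrow> 'k::field) \<Rightarrow> (expv list \<Rightarrow> 'k) \<Rightarrow> expv list \<Rightarrow> 'k" where
  "bd i m x c' = (\<Sum>c\<in>chains (Suc i). m c' c * x c)"

lemma finite_chains: "finite (chains i)"
  by (rule finite_subset[OF _ finite_lists_length_eq[OF finite_G, of i]]) (auto simp: chains_def)

lemma finite_chains_at: "finite (chains_at i s)"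
  using finite_chains by (auto simp: chains_at_def)

lemma chains_0: "chains 0 = {[]}"
  by (auto simp: chains_def)

lemma chains_SucD:
  assumes "c \<in> chains (Suc i)"
  shows "c = hd c # tl c" "hd c \<in> G" "tl c \<in> chains i"
    and "sum_list c = hd c + sum_list (tl c)"
proof -
  obtain a t where c: "c = a # t"
    using assms by (cases c) (auto simp: chains_def)
  show "c = hd c # tl c" "hd c \<in> G" "tl c \<in> chains i" "sum_list c = hd c + sum_list (tl c)"
    using assms by (auto simp: c chains_def successively_Cons)
qed

lemma chains_atE:
  assumes "c \<in> chains_at i s"
  obtains r where "r \<in> semigrp G" "s = r + sum_list c" "s - sum_list c = r" "c \<in> chains i"
  using assms by (auto simp: chains_at_def)

lemma full_word_inj:
  assumes "c \<in> chains i" "c' \<in> chains i" "full_word s c = full_word s c'"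
  shows "c = c'"
  using assms by (auto simp: full_word_def chains_def append_eq_append_conv)

text \<open>With \<open>r = s - sum_list c\<close>, the comparison runs through the word
  \<open>nf r\<close> followed by \<open>a\<close> and \<open>c'\<close>: normalizing its prefix can
  only lower it, and replacing \<open>a # c'\<close> by \<open>c\<close> can only raise it. The
  second comparison is strict if \<open>a # c' < c\<close>; the first is strict if the prefix was
  not standard, which is what failure of \<open>reduced\<close> says when
  \<open>c' = tl c\<close>.\<close>

lemma full_word_step:
  assumes c: "c \<in> chains_at (Suc i) s" and c': "c' \<in> chains i" and a: "a \<in> G"
    and sum: "a + sum_list c' = sum_list c" and le: "a # c' \<le> c"
  shows "c' \<in> chains_at i s" "full_word s c' \<le> full_word s c"
    "a # c' < c \<or> (c' = tl c \<and> \<not> reduced s c) \<Longrightarrow> full_word s c' < full_word s c"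
proof -
  obtain r where r: "r \<in> semigrp G" "s = r + sum_list c" "s - sum_list c = r"
    using c by (elim chains_atE)
  have s: "s = (r + a) + sum_list c'"
    by (simp add: r(2) add.assoc sum)
  have ra: "r + a \<in> semigrp G"
    using r a by (simp add: semigrp_add semigrp_base)
  show "c' \<in> chains_at i s"
    using c' s ra by (auto simp: chains_at_def)
  have w: "full_word s c' = nf (r + a) @ c'" "full_word s c = nf r @ c"
    using s r by (simp_all add: full_word_def)
  have len: "length (nf (r + a)) = length (nf r @ [a])"
    using length_nf_add[OF r(1) a] by simp
  have 1: "nf (r + a) @ c' \<le> (nf r @ [a]) @ c'"
    using nf_add_le[OF r(1) a] append_less_append_right[OF _ len, of c' c']
    by (auto simp: le_less)
  have 2: "(nf r @ [a]) @ c' \<le> nf r @ c"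
    using le by simp
  show "full_word s c' \<le> full_word s c"
    unfolding w using 1 2 by (rule order_trans)
  assume "a # c' < c \<or> (c' = tl c \<and> \<not> reduced s c)"
  then show "full_word s c' < full_word s c"
  proof
    assume "a # c' < c"
    then have "(nf r @ [a]) @ c' < nf r @ c" by simp
    with 1 w show ?thesis by (metis order_le_less_trans)
  next
    assume t: "c' = tl c \<and> \<not> reduced s c"
    have c_ne: "c \<noteq> []" "c \<in> chains (Suc i)"
      using c by (auto simp: chains_at_def chains_def)
    have ha: "hd c = a"
      using t sum chains_SucD(4)[OF c_ne(2)] by (metis add_right_cancel)
    have "\<not> std_word G (nf r @ [a])"
      using t c_ne ha r(3) by (auto simp: reduced_def std_word_def successively_append_iff)
    then have "nf (r + a) \<noteq> nf r @ [a]"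
      using nf_std[OF ra] by metis
    then have "nf (r + a) < nf r @ [a]"
      using nf_add_le[OF r(1) a] by simp
    then have "nf (r + a) @ c' < (nf r @ [a]) @ c'"
      using append_less_append_right len by blast
    with 2 w show ?thesis by (metis order_less_le_trans)
  qed
qed

text \<open>The leading row in terms of full words: a row of column \<open>c\<close> can reach the
  full word of \<open>c\<close> only if it is \<open>tl c\<close> and \<open>c\<close> is
  reduced.\<close>

lemma triangular_lead:
  assumes m: "triangular i m" and c: "c \<in> chains_at (Suc i) s" and c': "c' \<in> chains i"
    and nz: "m c' c \<noteq> 0"
  shows "c' \<in> chains_at i s" "full_word s c' \<le> full_word s c"
    "c' \<noteq> tl c \<or> \<not> reduced s c \<Longrightarrow> full_word s c' < full_word s c"
proof -
  have cc: "c \<in> chains (Suc i)" using c by (auto simp: chains_at_def)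
  note D = chains_SucD[OF cc]
  have "\<exists>a\<in>G. a + sum_list c' = sum_list c \<and> (if c' = tl c then a # c' = c else a # c' < c)"
  proof (cases "c' = tl c")
    case True
    then show ?thesis using D by (intro bexI[of _ "hd c"]) auto
  next
    case False
    then show ?thesis using m cc c' nz by (auto simp: triangular_def)
  qed
  then obtain a where a: "a \<in> G" "a + sum_list c' = sum_list c"
    "if c' = tl c then a # c' = c else a # c' < c" by blast
  have le: "a # c' \<le> c" using a(3) by (auto split: if_splits)
  note F = full_word_step[OF c c' a(1,2) le]
  show "c' \<in> chains_at i s" "full_word s c' \<le> full_word s c" using F by auto
  assume "c' \<noteq> tl c \<or> \<not> reduced s c"
  then show "full_word s c' < full_word s c"
    using F(3) a(3) by (auto split: if_splits)
qed

text \<open>Since \<open>c\<close> is reduced, appending \<open>hd c\<close> to the normal form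
  keeps it standard, so this letter passes from the chain to the prefix and the full word stays. If
  \<open>tl c\<close> is nonempty, the letter forms a nonstandard pair with the next one, because
  \<open>c\<close> is a chain.\<close>

lemma reduced_tl:
  assumes c: "c \<in> chains_at (Suc i) s" and red: "reduced s c"
  shows "tl c \<in> chains_at i s" "full_word s (tl c) = full_word s c" "\<not> reduced s (tl c)"
proof -
  obtain r where r: "r \<in> semigrp G" "s = r + sum_list c" "s - sum_list c = r" and cc: "c \<in> chains (Suc i)"
    using c by (elim chains_atE)
  note D = chains_SucD[OF cc]
  have s: "s = (r + hd c) + sum_list (tl c)"
    using r(2) D(4) by (simp add: add.assoc)
  have "std_word G (nf r @ [hd c])"
    using red nf_std[OF r(1)] D(2)
    by (auto simp: reduced_def r(3) std_word_def successively_append_iff)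
  from nf_std_word[OF this] have nf: "nf (r + hd c) = nf r @ [hd c]"
    using nf_sum[OF r(1)] by simp
  have d: "s - sum_list (tl c) = r + hd c"
    using s by simp
  show "tl c \<in> chains_at i s"
    using s D r semigrp_add semigrp_base by (auto simp: chains_at_def)
  show "full_word s (tl c) = full_word s c"
    using D(1) by (simp add: full_word_def d nf r(3))
  have "tl c \<noteq> [] \<Longrightarrow> \<not> std_pair G (hd c) (hd (tl c))"
  proof -
    have "successively (\<lambda>u v. \<not> std_pair G u v) (hd c # tl c)"
      using cc D(1) by (auto simp: chains_def)
    then show "tl c \<noteq> [] \<Longrightarrow> \<not> std_pair G (hd c) (hd (tl c))"
      by (simp add: successively_Cons)
  qed
  then show "\<not> reduced s (tl c)"
    by (auto simp: reduced_def d nf)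
qed

text \<open>The inverse of the matching: the last letter of the normal form moves to the front of
  \<open>c\<close>. Failure of \<open>reduced\<close> says that there is such a letter and that the
  longer word is again a chain.\<close>

lemma not_reduced_lift:
  assumes c: "c \<in> chains_at i s" and nred: "\<not> reduced s c"
  obtains b where "b \<in> chains_at (Suc i) s" "reduced s b" "tl b = c"
proof -
  obtain r where r: "r \<in> semigrp G" "s = r + sum_list c" "s - sum_list c = r" and cc: "c \<in> chains i"
    using c by (elim chains_atE)
  define w where "w = butlast (nf r)"
  define a where "a = last (nf r)"
  have ne: "nf r \<noteq> []" and np: "c \<noteq> [] \<Longrightarrow> \<not> std_pair G a (hd c)"
    using nred by (auto simp: reduced_def r(3) a_def)
  then have nfr: "nf r = w @ [a]" by (simp add: w_def a_def)
  have std: "std_word G (w @ [a])" using nf_std[OF r(1)] nfr by simp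
  then have w: "std_word G w" "set w \<subseteq> G" "a \<in> G"
    and wa: "w \<noteq> [] \<Longrightarrow> std_pair G (last w) a"
    by (auto simp: std_word_def successively_append_iff)
  have rs: "r = sum_list w + a" using nf_sum[OF r(1)] nfr by simp
  have d: "s - sum_list (a # c) = sum_list w" 
    unfolding r(2) rs by (metis add.assoc add_diff_cancel_right' sum_list.Cons)
  have "a # c \<in> chains (Suc i)"
    using cc w np by (auto simp: chains_def successively_Cons)
  moreover have "s = sum_list w + sum_list (a # c)"
    using r(2) rs by (simp add: add.assoc)
  ultimately have "a # c \<in> chains_at (Suc i) s"
    using w sum_list_in_semigrp by (auto simp: chains_at_def)
  moreover have "reduced s (a # c)"
    using wa unfolding reduced_def d nf_std_word[OF w(1)] by auto
  ultimately show thesis using that[of "a # c"] by simp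
qed

end

lemma ex_max_on:
  fixes f :: "'a \<Rightarrow> 'b::linorder"
  assumes "finite A" "A \<noteq> {}"
  shows "\<exists>b\<in>A. \<forall>e\<in>A. f e \<le> f b"
proof -
  have "Max (f ` A) \<in> f ` A" using assms by simp
  then obtain b where "b \<in> A" "f b = Max (f ` A)" by auto
  moreover have "f e \<le> Max (f ` A)" if "e \<in> A" for e using that assms by simp
  ultimately show ?thesis by (intro bexI[of _ b]) auto
qed

section \<open>Exactness in a fixed multidegree by elimination\<close>

context pbw_set
begin

definition supp_on :: "expv list set \<Rightarrow> (expv list \<Rightarrow> 'k::zero) \<Rightarrow> bool" where
  "supp_on A x \<longleftrightarrow> (\<forall>c. x c \<noteq> 0 \<longrightarrow> c \<in> A)"

lemma bd_add: "bd i m (\<lambda>c. x c + y c) c' = bd i m x c' + bd i m y c'"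
  by (simp add: bd_def distrib_left sum.distrib)

lemma bd_diff: "bd i m (\<lambda>c. x c - y c) c' = bd i m x c' - bd i m y c'"
  by (simp add: bd_def right_diff_distrib sum_subtractf)

lemma bd_unit:
  assumes "c \<in> chains (Suc i)"
  shows "bd i m (\<lambda>e. if e = c then k else 0) c' = m c' c * k"
proof -
  have "bd i m (\<lambda>e. if e = c then k else 0) c' = (\<Sum>e\<in>chains (Suc i). if e = c then m c' c * k else 0)"
    unfolding bd_def by (rule sum.cong) auto
  also have "\<dots> = m c' c * k"
    using assms by (simp add: finite_chains)
  finally show ?thesis .
qed

lemma bd_supp_on:
  assumes m: "triangular i m" and x: "supp_on (chains_at (Suc i) s) x"
    and c': "c' \<in> chains i" "bd i m x c' \<noteq> 0"
  shows "c' \<in> chains_at i s"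
proof -
  obtain c where "c \<in> chains (Suc i)" "m c' c * x c \<noteq> 0"
    using c'(2) unfolding bd_def by (meson sum.neutral)
  then show ?thesis
    using triangular_lead(1)[OF m _ c'(1)] x by (auto simp: supp_on_def)
qed

text \<open>Take \<open>b\<close> in the support of \<open>x\<close> with the largest full word. Row
  \<open>tl b\<close> has the same full word, so a contributing column \<open>e\<close> has a full
  word at least as large, hence the same one, hence \<open>e = b\<close>. Row \<open>tl b\<close>
  therefore reads \<open>x b = 0\<close>.\<close>

lemma bd_inj_reduced:
  assumes m: "triangular i m" and x: "supp_on {c \<in> chains_at (Suc i) s. reduced s c} x"
    and 0: "\<And>c'. c' \<in> chains i \<Longrightarrow> bd i m x c' = 0"
  shows "x c = 0"
proof (rule ccontr)
  assume "x c \<noteq> 0"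
  define A where "A = {c. x c \<noteq> 0}"
  have A: "A \<subseteq> {c \<in> chains_at (Suc i) s. reduced s c}"
    using x by (auto simp: A_def supp_on_def)
  have fin: "finite A"
    by (rule finite_subset[OF A]) (simp add: finite_chains_at)
  have ne: "A \<noteq> {}" using \<open>x c \<noteq> 0\<close> by (auto simp: A_def)
  obtain b where b: "b \<in> A" "\<And>e. e \<in> A \<Longrightarrow> full_word s e \<le> full_word s b"
    using ex_max_on[OF fin ne, of "full_word s"] by blast
  have b': "b \<in> chains_at (Suc i) s" "reduced s b" "b \<in> chains (Suc i)"
    using b(1) A by (auto simp: chains_at_def)
  have "bd i m x (tl b) = (\<Sum>e\<in>chains (Suc i). if e = b then x b else 0)"
    unfolding bd_def
  proof (rule sum.cong[OF refl])
    fix e assume e: "e \<in> chains (Suc i)"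
    show "m (tl b) e * x e = (if e = b then x b else 0)"
    proof (cases "e = b")
      case True
      then show ?thesis using m b'(3) by (simp add: triangular_def)
    next
      case False
      have "m (tl b) e = 0" if "x e \<noteq> 0"
      proof (rule ccontr)
        assume nz: "m (tl b) e \<noteq> 0"
        have eA: "e \<in> A" using that by (simp add: A_def)
        then have "e \<in> chains_at (Suc i) s" using A by auto
        then have "full_word s (tl b) \<le> full_word s e"
          using triangular_lead(2)[OF m _ _ nz] chains_SucD(3)[OF b'(3)] by blast
        then have "full_word s b \<le> full_word s e"
          using reduced_tl(2)[OF b'(1,2)] by simp
        then have "full_word s b = full_word s e"
          using b(2)[OF eA] by simp
        then show False
          using full_word_inj[OF b'(3) e] False by simp
      qed
      then show ?thesis using False by auto
    qed
  qed
  also have "\<dots> = x b" using b'(3) by (simp add: finite_chains)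
  finally have "x b = 0"
    using 0[OF chains_SucD(3)[OF b'(3)]] by simp
  then show False using b(1) by (simp add: A_def)
qed

text \<open>Gaussian elimination of the nonreduced part of \<open>z\<close>, from the largest full
  word downwards, with the reduced lifts as pivots. The bound \<open>B\<close> is carried along
  because a new differential may only have terms below a prescribed word.\<close>

lemma reduce_mod_bd:
  assumes m: "triangular i m"
  shows "supp_on (chains_at i s) z \<Longrightarrow>
     (\<And>c. z c \<noteq> 0 \<Longrightarrow> \<not> reduced s c \<Longrightarrow> full_word s c < B) \<Longrightarrow>
     \<exists>y. supp_on {c \<in> chains_at (Suc i) s. reduced s c \<and> full_word s c < B} y \<and>
         (\<forall>c\<in>chains i. z c - bd i m y c \<noteq> 0 \<longrightarrow> reduced s c)"
proof (induction "card {c \<in> chains_at i s. \<not> reduced s c \<and> full_word s c < B}" arbitrary: z B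
    rule: less_induct)
  case less
  define A where "A = {c. z c \<noteq> 0 \<and> \<not> reduced s c}"
  have A: "A \<subseteq> chains_at i s"
    using less.prems(1) by (auto simp: A_def supp_on_def)
  have fin: "finite A"
    by (rule finite_subset[OF A]) (simp add: finite_chains_at)
  show ?case
  proof (cases "A = {}")
    case True
    then show ?thesis
      by (intro exI[of _ "\<lambda>_. 0"]) (auto simp: supp_on_def bd_def A_def)
  next
    case False
    obtain c where c: "c \<in> A" "\<And>e. e \<in> A \<Longrightarrow> full_word s e \<le> full_word s c"
      using ex_max_on[OF fin False, of "full_word s"] by blast
    have c': "c \<in> chains_at i s" "\<not> reduced s c" "z c \<noteq> 0" "full_word s c < B"
      using c(1) A less.prems(2) by (auto simp: A_def)
    obtain b where b: "b \<in> chains_at (Suc i) s" "reduced s b" "tl b = c"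
      using not_reduced_lift[OF c'(1,2)] .
    have bc: "b \<in> chains (Suc i)" using b(1) by (simp add: chains_at_def)
    have wb: "full_word s b = full_word s c"
      using reduced_tl(2)[OF b(1,2)] b(3) by simp
    \<comment> \<open>The column of the lift \<open>b\<close> has entry 1 in row
      \<open>tl b = c\<close>, so subtracting \<open>z c\<close> times this column cancels the entry
      at \<open>c\<close>.\<close>
    define u where "u = (\<lambda>e. if e = b then z c else 0)"
    have bdu: "bd i m u e = m e b * z c" for e
      unfolding u_def by (rule bd_unit[OF bc])
    have mcb: "m c b = 1" using m bc b(3) by (auto simp: triangular_def)
    \<comment> \<open>The cut-off to \<open>chains i\<close> matters: \<open>triangular\<close> does
      not control other rows.\<close>
    define z' where "z' = (\<lambda>e. if e \<in> chains i then z e - bd i m u e else 0)"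
    have z'_supp: "supp_on (chains_at i s) z'"
      unfolding supp_on_def
    proof (intro allI impI)
      fix e assume "z' e \<noteq> 0"
      then have "e \<in> chains i" "z e \<noteq> 0 \<or> m e b \<noteq> 0"
        by (auto simp: z'_def bdu split: if_splits)
      then show "e \<in> chains_at i s"
        using triangular_lead(1)[OF m b(1)] less.prems(1) by (auto simp: supp_on_def)
    qed
    have z'_lt: "full_word s e < full_word s c" if e: "z' e \<noteq> 0" "\<not> reduced s e" for e
    proof -
      have ei: "e \<in> chains i" using e(1) by (auto simp: z'_def split: if_splits)
      have ec: "e \<noteq> c" using e(1) mcb by (auto simp: z'_def bdu split: if_splits)
      show ?thesis
      proof (cases "m e b = 0")
        case True
        then have "e \<in> A" using e ei by (auto simp: A_def z'_def bdu)
        then have "full_word s e \<le> full_word s c" using c(2) by blast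
        moreover have "full_word s e \<noteq> full_word s c"
          using full_word_inj[OF ei] c'(1) ec by (auto simp: chains_at_def)
        ultimately show ?thesis by simp
      next
        case False
        then show ?thesis
          using triangular_lead(3)[OF m b(1) ei] ec b(3) wb by auto
      qed
    qed
    \<comment> \<open>\<open>c\<close> lies below \<open>B\<close> but not below its own full word,
      so the induction measure drops.\<close>
    have "card {e \<in> chains_at i s. \<not> reduced s e \<and> full_word s e < full_word s c}
        < card {e \<in> chains_at i s. \<not> reduced s e \<and> full_word s e < B}"
    proof (rule psubset_card_mono)
      show "finite {e \<in> chains_at i s. \<not> reduced s e \<and> full_word s e < B}"
        by (simp add: finite_chains_at)
      have "c \<in> {e \<in> chains_at i s. \<not> reduced s e \<and> full_word s e < B}"
        using c' by simp
      moreover have "{e \<in> chains_at i s. \<not> reduced s e \<and> full_word s e < full_word s c}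
        \<subseteq> {e \<in> chains_at i s. \<not> reduced s e \<and> full_word s e < B}"
        using c'(4) by auto
      ultimately show "{e \<in> chains_at i s. \<not> reduced s e \<and> full_word s e < full_word s c}
        \<subset> {e \<in> chains_at i s. \<not> reduced s e \<and> full_word s e < B}" by auto
    qed
    from less.hyps[OF this z'_supp z'_lt]
    obtain y where y: "supp_on {e \<in> chains_at (Suc i) s. reduced s e \<and> full_word s e < full_word s c} y"
      "\<And>e. e \<in> chains i \<Longrightarrow> z' e - bd i m y e \<noteq> 0 \<Longrightarrow> reduced s e" by blast
    have "supp_on {e \<in> chains_at (Suc i) s. reduced s e \<and> full_word s e < B} (\<lambda>e. u e + y e)"
      unfolding supp_on_def
    proof (intro allI impI)
      fix e assume "u e + y e \<noteq> 0"
      then have "e = b \<or> y e \<noteq> 0" by (auto simp: u_def split: if_splits)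
      then show "e \<in> {e \<in> chains_at (Suc i) s. reduced s e \<and> full_word s e < B}"
        using b wb c'(4) y(1) by (auto simp: supp_on_def)
    qed
    moreover have "reduced s e" if "e \<in> chains i" "z e - bd i m (\<lambda>e. u e + y e) e \<noteq> 0" for e
      using y(2)[OF that(1)] that by (auto simp: bd_add z'_def algebra_simps)
    ultimately show ?thesis by blast
  qed
qed

text \<open>The augmentation kills exactly the multidegrees other than \<open>0\<close>, so in homological degree
  \<open>0\<close> every element of nonzero multidegree is a cycle.\<close>

definition cycle :: "nat \<Rightarrow> (expv list \<Rightarrow> expv list \<Rightarrow> 'k::field) \<Rightarrow> expv \<Rightarrow> (expv list \<Rightarrow> 'k) \<Rightarrow> bool" where
  "cycle i m s z \<longleftrightarrow> supp_on (chains_at i s) z \<and>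
     (case i of 0 \<Rightarrow> s \<noteq> 0 | Suc j \<Rightarrow> \<forall>c\<in>chains j. bd j m z c = 0)"

text \<open>\<open>m\<close> is the differential from homological degree \<open>i\<close> to
  \<open>i - 1\<close>, and \<open>m'\<close> the one from \<open>i + 1\<close> to \<open>i\<close>.
  In degree 0 the augmentation takes the place of \<open>m\<close>.\<close>

definition complex_step :: "nat \<Rightarrow> (expv list \<Rightarrow> expv list \<Rightarrow> 'k::field) \<Rightarrow> (expv list \<Rightarrow> expv list \<Rightarrow> 'k) \<Rightarrow> bool" where
  "complex_step i m m' \<longleftrightarrow> (case i of 0 \<Rightarrow> True
     | Suc j \<Rightarrow> triangular j m \<and> (\<forall>c\<in>chains (Suc i). \<forall>c'\<in>chains j. bd j m (\<lambda>e. m' e c) c' = 0))"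

lemma bd_bd:
  assumes "complex_step (Suc j) m m'" "c' \<in> chains j"
  shows "bd j m (bd (Suc j) m' x) c' = 0"
proof -
  have "bd j m (bd (Suc j) m' x) c' = (\<Sum>c\<in>chains (Suc (Suc j)). bd j m (\<lambda>e. m' e c) c' * x c)"
    unfolding bd_def sum_distrib_left sum_distrib_right
    by (subst sum.swap) (simp add: mult.assoc)
  also have "\<dots> = 0"
    using assms by (intro sum.neutral) (auto simp: complex_step_def)
  finally show ?thesis .
qed

lemma bd_cong: "(\<And>c. c \<in> chains (Suc i) \<Longrightarrow> x c = y c) \<Longrightarrow> bd i m x c' = bd i m y c'"
  unfolding bd_def by (rule sum.cong) auto

text \<open>After elimination the remainder of a cycle is a cycle supported on reduced chains, and
  the differential is injective on those. The solution \<open>y\<close> is itself supported on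
  reduced chains below \<open>B\<close>; \<open>next_differential\<close> relies on both
  facts.\<close>

lemma exactness:
  assumes st: "complex_step i m m'" and m': "triangular i m'" and z: "cycle i m s z"
    and B: "\<And>c. z c \<noteq> 0 \<Longrightarrow> full_word s c < B"
  shows "\<exists>y. supp_on {c \<in> chains_at (Suc i) s. reduced s c \<and> full_word s c < B} y \<and>
    (\<forall>c\<in>chains i. bd i m' y c = z c)"
proof -
  have zs: "supp_on (chains_at i s) z" using z by (simp add: cycle_def)
  obtain y where y: "supp_on {c \<in> chains_at (Suc i) s. reduced s c \<and> full_word s c < B} y"
    and red: "\<And>c. c \<in> chains i \<Longrightarrow> z c - bd i m' y c \<noteq> 0 \<Longrightarrow> reduced s c"
    using reduce_mod_bd[OF m' zs, of B] B by blast
  have ys: "supp_on (chains_at (Suc i) s) y" using y by (auto simp: supp_on_def)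
  define r where "r = (\<lambda>c. if c \<in> chains i then z c - bd i m' y c else 0)"
  have r: "supp_on {c \<in> chains_at i s. reduced s c} r"
    unfolding supp_on_def
  proof (intro allI impI)
    fix c assume "r c \<noteq> 0"
    then have c: "c \<in> chains i" "z c - bd i m' y c \<noteq> 0" by (auto simp: r_def split: if_splits)
    then have "z c \<noteq> 0 \<or> bd i m' y c \<noteq> 0" by auto
    then have "c \<in> chains_at i s"
      using zs bd_supp_on[OF m' ys c(1)] by (auto simp: supp_on_def)
    then show "c \<in> {c \<in> chains_at i s. reduced s c}" using red c by auto
  qed
  have "r c = 0" for c
  proof (cases i)
    \<comment> \<open>The only chain is \<open>[]\<close>, which is reduced only in multidegree 0,
      whereas cycles have \<open>s \<noteq> 0\<close>.\<close>
    case 0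
    show ?thesis
    proof (rule ccontr)
      assume "r c \<noteq> 0"
      then have c: "c \<in> chains_at 0 s" "reduced s c" using r 0 by (auto simp: supp_on_def)
      then have "c = []" "s \<in> semigrp G" "nf s = []"
        by (auto simp: chains_at_def chains_0 reduced_def)
      then show False
        using z 0 nf_eq_Nil_iff by (auto simp: cycle_def)
    qed
  next
    case (Suc j)
    have "bd j m r c' = 0" if c': "c' \<in> chains j" for c'
    proof -
      have "bd j m r c' = bd j m (\<lambda>c. z c - bd i m' y c) c'"
        by (rule bd_cong) (simp add: r_def Suc)
      also have "\<dots> = bd j m z c' - bd j m (bd (Suc j) m' y) c'"
        by (simp add: bd_diff Suc)
      also have "\<dots> = 0"
        using z c' bd_bd[OF st[unfolded Suc] c'] by (simp add: cycle_def Suc)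
      finally show ?thesis .
    qed
    moreover have "triangular j m" using st by (simp add: complex_step_def Suc)
    ultimately show ?thesis
      using bd_inj_reduced[of j m s r c] r by (simp add: Suc)
  qed
  then have "\<forall>c\<in>chains i. bd i m' y c = z c"
    by (metis r_def eq_iff_diff_eq_0)
  with y show ?thesis by blast
qed

text \<open>The column of \<open>c\<close> is built in multidegree \<open>sum_list c\<close>: start
  from the monomial of \<open>hd c\<close> times the generator \<open>tl c\<close>. Its image under
  \<open>m'\<close> is a cycle with all terms below \<open>c\<close>; subtract the preimage of this
  image that \<open>exactness\<close> supplies.\<close>

lemma next_differential:
  assumes st: "complex_step i m m'" and m': "triangular i m'"
  shows "\<exists>m''. triangular (Suc i) m'' \<and> complex_step (Suc i) m' m''"
proof -
  have "\<exists>x. x (tl c) = 1 \<and> (\<forall>c'\<in>chains (Suc i). c' \<noteq> tl c \<longrightarrow> x c' \<noteq> 0 \<longrightarrow>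
          (\<exists>a\<in>G. a + sum_list c' = sum_list c \<and> a # c' < c)) \<and>
        (\<forall>c'\<in>chains i. bd i m' x c' = 0)" if c: "c \<in> chains (Suc (Suc i))" for c
  proof -
    define s where "s = sum_list c"
    define t where "t = tl c"
    define a where "a = hd c"
    note D = chains_SucD[OF c, folded t_def a_def s_def]
    have st_t: "s - sum_list t = a" using D(4) by simp
    have t_at: "t \<in> chains_at (Suc i) s"
      using D semigrp_base by (auto simp: chains_at_def)
    have wt: "full_word s t = c"
      using D(1) nf_single[OF D(2)] by (simp add: full_word_def st_t)
    have "t \<noteq> []" using D(3) by (auto simp: chains_def)
    moreover have "successively (\<lambda>u v. \<not> std_pair G u v) (a # t)"
      using c D(1) by (simp add: chains_def)
    ultimately have t_nred: "\<not> reduced s t"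
      using nf_single[OF D(2)] by (auto simp: reduced_def st_t successively_Cons)
    define z where "z = (\<lambda>e. if e \<in> chains i then m' e t else 0)"
    have z_lt: "e \<in> chains_at i s" "full_word s e < c" if "z e \<noteq> 0" for e
      using triangular_lead(1,3)[OF m' t_at, of e] that t_nred wt
      by (auto simp: z_def split: if_splits)
    have "cycle i m s z"
    proof (cases i)
      case 0
      have "s \<noteq> 0"
      proof
        assume "s = 0"
        then have "length c = length ([]::expv list)"
          using c by (intro length_eq) (auto simp: s_def chains_def)
        then show False using c by (simp add: chains_def)
      qed
      then show ?thesis using z_lt 0 by (auto simp: cycle_def supp_on_def)
    next
      case (Suc j)
      have "bd j m z c' = 0" if "c' \<in> chains j" for c'
      proof -
        have "bd j m z c' = bd j m (\<lambda>e. m' e t) c'"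
          by (rule bd_cong) (simp add: z_def Suc)
        then show ?thesis using st that D(3) by (simp add: complex_step_def Suc)
      qed
      then show ?thesis using z_lt by (auto simp: cycle_def supp_on_def Suc)
    qed
    from exactness[OF st m' this z_lt(2)]
    obtain y where y: "supp_on {e \<in> chains_at (Suc i) s. reduced s e \<and> full_word s e < c} y"
      and yz: "\<And>e. e \<in> chains i \<Longrightarrow> bd i m' y e = z e" by blast
    \<comment> \<open>\<open>t\<close> is not reduced while \<open>y\<close> lives on reduced
      chains, so the entry 1 at \<open>t\<close> survives the subtraction.\<close>
    define x where "x = (\<lambda>e. (if e = t then 1 else 0) - y e)"
    have "y t = 0" using y t_nred by (auto simp: supp_on_def)
    then have "x t = 1" by (simp add: x_def)
    moreover have "\<exists>a\<in>G. a + sum_list e = s \<and> a # e < c"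
      if e: "e \<in> chains (Suc i)" "e \<noteq> t" "x e \<noteq> 0" for e
    proof -
      have "y e \<noteq> 0" using e by (simp add: x_def)
      then have e_at: "e \<in> chains_at (Suc i) s" "full_word s e < c"
        using y by (auto simp: supp_on_def)
      obtain r where r: "r \<in> semigrp G" "s = r + sum_list e" "s - sum_list e = r"
        using e_at(1) by (elim chains_atE)
      \<comment> \<open>Linearity comes out here: \<open>e\<close> is one letter shorter than
        \<open>c\<close> and its full word has the same sum as \<open>c\<close>, so the monomial in
        front of \<open>e\<close> is a single letter.\<close>
      have "length (nf r @ e) = length c"
      proof (rule length_eq)
        show "set (nf r @ e) \<subseteq> G" "set c \<subseteq> G"
          using nf_set[OF r(1)] e(1) c by (auto simp: chains_def)
        show "sum_list (nf r @ e) = sum_list c"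
          using nf_sum[OF r(1)] r(2) by (simp add: s_def)
      qed
      then have "length (nf r) = Suc 0"
        using e(1) c by (simp add: chains_def)
      then obtain b where b: "nf r = [b]" by (metis length_0_conv length_Suc_conv)
      then have "b \<in> G" "r = b" using nf_set[OF r(1)] nf_sum[OF r(1)] by auto
      then show ?thesis
        using e_at(2) r b by (auto simp: full_word_def)
    qed
    moreover have "bd i m' x c' = 0" if "c' \<in> chains i" for c'
      using yz[OF that] that D(3) by (simp add: x_def bd_diff bd_unit z_def)
    ultimately show ?thesis by (auto simp: s_def t_def)
  qed
  then obtain X where X: "\<And>c. c \<in> chains (Suc (Suc i)) \<Longrightarrow> X c (tl c) = 1 \<and>
       (\<forall>c'\<in>chains (Suc i). c' \<noteq> tl c \<longrightarrow> X c c' \<noteq> 0 \<longrightarrow>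
          (\<exists>a\<in>G. a + sum_list c' = sum_list c \<and> a # c' < c)) \<and>
        (\<forall>c'\<in>chains i. bd i m' (X c) c' = 0)"
    by metis
  show ?thesis
    using X m' by (intro exI[of _ "\<lambda>c' c. X c c'"]) (auto simp: triangular_def complex_step_def)
qed

text \<open>Dependent choice of pairs of consecutive differentials. \<open>triangular\<close> forces
  \<open>m 1\<close> to have entry 1 in every column \<open>[a]\<close>, so that \<open>[a]\<close>
  is sent to \<open>t^a\<close>; \<open>m 0\<close> is a placeholder.\<close>

lemma ex_differentials:
  "\<exists>m :: nat \<Rightarrow> expv list \<Rightarrow> expv list \<Rightarrow> 'k::field.
     \<forall>i. triangular i (m (Suc i)) \<and> complex_step i (m i) (m (Suc i))"
proof -
  define P where "P i p \<longleftrightarrow> triangular i (snd p) \<and> complex_step i (fst p) (snd p)"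
    for i and p :: "(expv list \<Rightarrow> expv list \<Rightarrow> 'k) \<times> (expv list \<Rightarrow> expv list \<Rightarrow> 'k)"
  have "\<exists>f. \<forall>i. P i (f i) \<and> snd (f i) = fst (f (Suc i))"
  proof (rule dependent_nat_choice)
    have "triangular 0 ((\<lambda>_ _. 1) :: expv list \<Rightarrow> expv list \<Rightarrow> 'k)"
      by (auto simp: triangular_def chains_0 chains_def length_Suc_conv)
    then show "\<exists>p. P 0 p"
      by (intro exI[of _ "(\<lambda>_ _. 1, \<lambda>_ _. 1)"]) (simp add: P_def complex_step_def)
  next
    fix p i assume "P i p"
    then obtain m'' where "triangular (Suc i) m''" "complex_step (Suc i) (snd p) m''"
      using next_differential[of i "fst p" "snd p"] by (auto simp: P_def)
    then show "\<exists>q. P (Suc i) q \<and> snd p = fst q"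
      by (intro exI[of _ "(snd p, m'')"]) (simp add: P_def)
  qed
  then obtain f where "\<And>i. P i (f i)" "\<And>i. snd (f i) = fst (f (Suc i))" by blast
  then show ?thesis
    by (intro exI[of _ "\<lambda>i. fst (f i)"]) (simp add: P_def)
qed

end

section \<open>The linear resolution\<close>

lemma lookup_single_times:
  fixes q :: "'a::cancel_comm_monoid_add \<Rightarrow>\<^sub>0 'k::comm_semiring_1"
  shows "Poly_Mapping.lookup (Poly_Mapping.single a k * q) (a + t) = k * Poly_Mapping.lookup q t"
proof -
  have "Poly_Mapping.lookup (Poly_Mapping.single a k * q) (a + t)
    = (\<Sum>l. (k * (\<Sum>u. Poly_Mapping.lookup q u when a + t = l + u)) when l = a)"
    unfolding lookup_mult lookup_single by (rule Sum_any.cong) (auto simp: when_def)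
  also have "\<dots> = k * (\<Sum>u. Poly_Mapping.lookup q u when u = t)"
    by (auto intro!: Sum_any.cong arg_cong[of _ _ "(*) k"] simp: when_def)
  finally show ?thesis by simp
qed

lemma lookup_single_times_eq_0:
  fixes q :: "'a::cancel_comm_monoid_add \<Rightarrow>\<^sub>0 'k::comm_semiring_1"
  assumes "\<And>t. p = a + t \<Longrightarrow> Poly_Mapping.lookup q t = 0"
  shows "Poly_Mapping.lookup (Poly_Mapping.single a k * q) p = 0"
proof (cases "\<exists>t. p = a + t")
  case True
  then show ?thesis using assms lookup_single_times[of a k q] by auto
next
  case False
  then have "p \<notin> Poly_Mapping.keys (Poly_Mapping.single a k * q)"
    using keys_mult[of "Poly_Mapping.single a k" q] by (auto split: if_splits)
  then show ?thesis by (simp add: in_keys_iff)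
qed

context pbw_set
begin

lemma exactness_unbounded:
  assumes "complex_step i m m'" "triangular i m'" "cycle i m s z"
  shows "\<exists>y. supp_on (chains_at (Suc i) s) y \<and> (\<forall>c\<in>chains i. bd i m' y c = z c)"
proof -
  \<comment> \<open>Appending any letter to the largest full word gives a strict upper bound, since
    a proper prefix is smaller.\<close>
  define B where "B = Max (full_word s ` chains_at i s) @ [0]"
  have "full_word s c < B" if "z c \<noteq> 0" for c
  proof -
    have "c \<in> chains_at i s" using assms(3) that by (simp add: cycle_def supp_on_def)
    then have "full_word s c \<le> Max (full_word s ` chains_at i s)"
      by (simp add: finite_chains_at)
    also have "\<dots> < B"
      unfolding B_def
      using append_less_append_left_iff[of "Max (full_word s ` chains_at i s)" "[]" "[0]"] by simp
    finally show ?thesis .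
  qed
  from exactness[OF assms this] show ?thesis
    by (auto simp: supp_on_def)
qed

end

text \<open>Numbers the chains so that the differentials become matrices indexed by naturals, as
  \<open>koszul\<close> requires; \<open>m (Suc i)\<close> maps homological degree
  \<open>Suc i\<close> to \<open>i\<close>.\<close>

locale pbw_resolution = pbw_set +
  fixes m :: "nat \<Rightarrow> expv list \<Rightarrow> expv list \<Rightarrow> 'k::field"
    and en :: "nat \<Rightarrow> nat \<Rightarrow> expv list"
  assumes m_tri: "triangular i (m (Suc i))"
    and m_step: "complex_step i (m i) (m (Suc i))"
    and en_bij: "bij_betw (en i) {..<card (chains i)} (chains i)"
begin

definition rk :: "nat \<Rightarrow> nat" where
  "rk i = card (chains i)"

definition ix :: "nat \<Rightarrow> expv list \<Rightarrow> nat" where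
  "ix i = the_inv_into {..<rk i} (en i)"

text \<open>For \<open>i \<ge> 1\<close>, rows belong to degree \<open>i - 1\<close> and columns to
  degree \<open>i\<close>. Subtraction of exponents is truncated, but in range a nonzero coefficient
  makes the difference a letter of \<open>G\<close>, by \<open>entry_degree\<close>; a zero
  coefficient gives the entry 0.\<close>

definition dmat :: "nat \<Rightarrow> nat \<Rightarrow> nat \<Rightarrow> 'k tpoly" where
  "dmat i r c = Poly_Mapping.single (sum_list (en i c) - sum_list (en (i - 1) r)) (m i (en (i - 1) r) (en i c))"

text \<open>The part of \<open>v\<close> in multidegree \<open>s\<close>, as a vector indexed by
  chains. The default 0 keeps truncated differences from being read as exponents.\<close>

definition comp :: "nat \<Rightarrow> expv \<Rightarrow> (nat \<Rightarrow> 'k tpoly) \<Rightarrow> expv list \<Rightarrow> 'k" where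
  "comp i s v c = (if c \<in> chains_at i s then Poly_Mapping.lookup (v (ix i c)) (s - sum_list c) else 0)"

abbreviation dmap :: "nat \<Rightarrow> (nat \<Rightarrow> 'k tpoly) \<Rightarrow> nat \<Rightarrow> 'k tpoly" where
  "dmap i \<equiv> mat_app (rk i) (rk (Suc i)) (dmat (Suc i))"

lemma en_in: "j < rk i \<Longrightarrow> en i j \<in> chains i"
  using en_bij[of i] by (auto simp: bij_betw_def rk_def)

lemma ix_en: "j < rk i \<Longrightarrow> ix i (en i j) = j"
  using en_bij[of i] by (simp add: ix_def rk_def bij_betw_def the_inv_into_f_f)

lemma en_ix: "c \<in> chains i \<Longrightarrow> en i (ix i c) = c"
  using en_bij[of i] by (simp add: ix_def rk_def bij_betw_def f_the_inv_into_f)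

lemma ix_less: "c \<in> chains i \<Longrightarrow> ix i c < rk i"
  using en_bij[of i] the_inv_into_into[of "en i" "{..<rk i}" c "{..<rk i}"]
  by (auto simp: ix_def rk_def bij_betw_def)

lemma rk_0: "rk 0 = 1"
  by (simp add: rk_def chains_0)

lemma entry_degree:
  assumes "c \<in> chains (Suc i)" "c' \<in> chains i" "m (Suc i) c' c \<noteq> 0"
  shows "\<exists>a\<in>G. sum_list c = a + sum_list c'"
  using m_tri[of i] assms chains_SucD[OF assms(1)] unfolding triangular_def by metis

lemma dmat_linear:
  assumes "r < rk i" "c < rk (Suc i)"
  shows "dmat (Suc i) r c \<in> semigroup_ring_deg1 G"
  using entry_degree[OF en_in[OF assms(2)] en_in[OF assms(1)]]
  by (auto simp: dmat_def semigroup_ring_deg1_def)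

lemma semigroup_ring_sum:
  assumes "\<And>j. j \<in> J \<Longrightarrow> f j \<in> semigroup_ring G"
  shows "sum f J \<in> semigroup_ring G"
  using assms
proof (induction J rule: infinite_finite_induct)
  case (insert j J)
  then have "Poly_Mapping.keys (f j) \<union> Poly_Mapping.keys (sum f J) \<subseteq> semigrp G"
    by (auto simp: semigroup_ring_def)
  then show ?case
    using insert keys_add[of "f j" "sum f J"] by (auto simp: semigroup_ring_def)
qed (auto simp: semigroup_ring_def)

lemma semigroup_ring_mult:
  assumes "p \<in> semigroup_ring G" "q \<in> semigroup_ring G"
  shows "p * q \<in> semigroup_ring G"
  using assms keys_mult[of p q] semigrp_add unfolding semigroup_ring_def by blast

lemma dmap_free_mod:
  assumes "v \<in> free_mod G (rk (Suc i))"
  shows "dmap i v \<in> free_mod G (rk i)"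
proof -
  have "dmat (Suc i) r c \<in> semigroup_ring G" if "r < rk i" "c < rk (Suc i)" for r c
    using dmat_linear[OF that] semigrp_base
    by (auto simp: semigroup_ring_def semigroup_ring_deg1_def)
  then show ?thesis
    using assms by (auto simp: free_mod_def mat_app_def intro!: semigroup_ring_sum semigroup_ring_mult)
qed

lemma supp_on_comp: "supp_on (chains_at i s) (comp i s v)"
  by (auto simp: supp_on_def comp_def)

text \<open>Passing to a multidegree turns the matrix over the semigroup ring into the scalar map
  \<open>bd\<close>, which reduces exactness over the ring to linear algebra.\<close>

lemma comp_dmap:
  assumes v: "v \<in> free_mod G (rk (Suc i))" and c': "c' \<in> chains i"
  shows "comp i s (dmap i v) c' = bd i (m (Suc i)) (comp (Suc i) s v) c'"
proof (cases "c' \<in> chains_at i s")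
  case False
  then show ?thesis
    using bd_supp_on[OF m_tri supp_on_comp c'] by (auto simp: comp_def)
next
  case True
  then obtain p where p: "p \<in> semigrp G" "s = p + sum_list c'" "s - sum_list c' = p"
    by (elim chains_atE)
  have entry: "Poly_Mapping.lookup (dmat (Suc i) (ix i c') j * v j) p
      = m (Suc i) c' (en (Suc i) j) * comp (Suc i) s v (en (Suc i) j)" if j: "j < rk (Suc i)" for j
  proof (cases "m (Suc i) c' (en (Suc i) j) = 0")
    case True
    then show ?thesis by (simp add: dmat_def en_ix[OF c'])
  next
    case False
    define c where "c = en (Suc i) j"
    have cc: "c \<in> chains (Suc i)" using en_in[OF j] by (simp add: c_def)
    obtain a where a: "a \<in> G" "sum_list c = a + sum_list c'"
      using entry_degree[OF cc c'] False by (auto simp: c_def)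
    have M: "dmat (Suc i) (ix i c') j = Poly_Mapping.single a (m (Suc i) c' c)"
      using a(2) by (simp add: dmat_def en_ix[OF c'] flip: c_def)
    show ?thesis
    proof (cases "c \<in> chains_at (Suc i) s")
      case True
      then obtain r where r: "r \<in> semigrp G" "s = r + sum_list c" "s - sum_list c = r"
        by (elim chains_atE)
      have "p + sum_list c' = (a + r) + sum_list c'"
        using p(2) r(2) a(2) by (simp add: ac_simps)
      then have "p = a + r" by simp
      then show ?thesis
        using True j by (simp add: M lookup_single_times comp_def r(3) ix_en flip: c_def)
          (simp add: c_def ix_en[OF j])
    next
      case nat: False
      have "Poly_Mapping.lookup (v j) t = 0" if t: "p = a + t" for t
      proof (rule ccontr)
        assume "Poly_Mapping.lookup (v j) t \<noteq> 0"
        then have "t \<in> semigrp G"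
          using v j by (auto simp: free_mod_def semigroup_ring_def simp flip: in_keys_iff)
        moreover have "s = t + sum_list c" using p(2) t a(2) by (simp add: ac_simps)
        ultimately show False using nat cc by (auto simp: chains_at_def)
      qed
      then show ?thesis
        using nat lookup_single_times_eq_0[of p a "v j"] by (simp add: M comp_def flip: c_def)
    qed
  qed
  have "comp i s (dmap i v) c' = (\<Sum>j<rk (Suc i). Poly_Mapping.lookup (dmat (Suc i) (ix i c') j * v j) p)"
    using True ix_less[OF c'] by (simp add: comp_def mat_app_def p(3) lookup_sum)
  also have "\<dots> = (\<Sum>j<rk (Suc i). m (Suc i) c' (en (Suc i) j) * comp (Suc i) s v (en (Suc i) j))"
    by (rule sum.cong) (use entry in auto)
  also have "\<dots> = bd i (m (Suc i)) (comp (Suc i) s v) c'"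
    unfolding bd_def
    using en_bij[of "Suc i"] by (intro sum.reindex_bij_betw) (simp add: rk_def)
  finally show ?thesis .
qed

lemma comp_eqI:
  assumes v: "v \<in> free_mod G (rk i)" and v': "v' \<in> free_mod G (rk i)"
    and eq: "\<And>s c. c \<in> chains i \<Longrightarrow> comp i s v c = comp i s v' c"
  shows "v = v'"
proof (rule ext)
  fix j
  show "v j = v' j"
  proof (cases "j < rk i")
    case False
    then show ?thesis using v v' by (simp add: free_mod_def)
  next
    case True
    show ?thesis
    proof (rule poly_mapping_eqI)
      fix p
      show "Poly_Mapping.lookup (v j) p = Poly_Mapping.lookup (v' j) p"
      proof (cases "p \<in> semigrp G")
        case T: True
        let ?c = "en i j"
        have "?c \<in> chains_at i (p + sum_list ?c)"
          using en_in[OF True] T by (auto simp: chains_at_def)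
        then show ?thesis
          using eq[of ?c "p + sum_list ?c"] en_in[OF True] ix_en[OF True] by (simp add: comp_def)
      next
        case False
        then have "p \<notin> Poly_Mapping.keys (v j)" "p \<notin> Poly_Mapping.keys (v' j)"
          using v v' True by (auto simp: free_mod_def semigroup_ring_def)
        then show ?thesis by (simp add: in_keys_iff)
      qed
    qed
  qed
qed

text \<open>Finiteness over \<open>s\<close> makes each coordinate a polynomial: its coefficient at
  \<open>p\<close> is read off in multidegree \<open>p + sum_list c\<close>.\<close>

lemma comp_surj:
  assumes y: "\<And>s. supp_on (chains_at i s) (y s)" and fin: "finite {s. y s \<noteq> (\<lambda>_. 0)}"
  shows "\<exists>v\<in>free_mod G (rk i). \<forall>s c. c \<in> chains i \<longrightarrow> comp i s v c = y s c"
proof -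
  define f where "f c p = (if p \<in> semigrp G then y (p + sum_list c) c else 0)" for c p
  have fin_f: "finite {p. f c p \<noteq> 0}" for c
  proof (rule finite_subset)
    show "{p. f c p \<noteq> 0} \<subseteq> (\<lambda>s. s - sum_list c) ` {s. y s \<noteq> (\<lambda>_. 0)}"
    proof
      fix p assume "p \<in> {p. f c p \<noteq> 0}"
      then have "y (p + sum_list c) \<noteq> (\<lambda>_. 0)" by (auto simp: f_def split: if_splits)
      then show "p \<in> (\<lambda>s. s - sum_list c) ` {s. y s \<noteq> (\<lambda>_. 0)}"
        by (intro image_eqI[of _ _ "p + sum_list c"]) auto
    qed
  qed (use fin in auto)
  define v where "v j = (if j < rk i then Abs_poly_mapping (f (en i j)) else 0)" for j
  have lk: "Poly_Mapping.lookup (v j) = f (en i j)" if "j < rk i" for j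
    using that fin_f by (simp add: v_def)
  have "v \<in> free_mod G (rk i)"
    unfolding free_mod_def semigroup_ring_def
  proof (intro CollectI conjI allI impI subsetI)
    fix j p assume "j < rk i" "p \<in> Poly_Mapping.keys (v j)"
    then show "p \<in> semigrp G" by (auto simp: in_keys_iff lk f_def split: if_splits)
  qed (simp add: v_def)
  moreover have "comp i s v c = y s c" if c: "c \<in> chains i" for s c
  proof (cases "c \<in> chains_at i s")
    case True
    then obtain r where r: "r \<in> semigrp G" "s = r + sum_list c" "s - sum_list c = r"
      by (elim chains_atE)
    have "comp i s v c = f c r"
      using True lk[OF ix_less[OF c]] by (simp add: comp_def r(3) en_ix[OF c])
    then show ?thesis using r by (simp add: f_def)
  next
    case False
    then show ?thesis using y[of s] by (auto simp: comp_def supp_on_def)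
  qed
  ultimately show ?thesis by blast
qed

lemma finite_comp_support:
  assumes "v \<in> free_mod G (rk i)"
  shows "finite {s. comp i s v \<noteq> (\<lambda>_. 0)}"
proof (rule finite_subset)
  show "{s. comp i s v \<noteq> (\<lambda>_. 0)} \<subseteq> (\<Union>c\<in>chains i. (\<lambda>p. p + sum_list c) ` Poly_Mapping.keys (v (ix i c)))"
  proof
    fix s assume "s \<in> {s. comp i s v \<noteq> (\<lambda>_. 0)}"
    then obtain c where "comp i s v c \<noteq> 0" by auto
    then have c: "c \<in> chains_at i s" "s - sum_list c \<in> Poly_Mapping.keys (v (ix i c))"
      by (auto simp: comp_def in_keys_iff split: if_splits)
    then obtain r where "s = r + sum_list c" "s - sum_list c = r" "c \<in> chains i"
      by (elim chains_atE)
    with c(2) show "s \<in> (\<Union>c\<in>chains i. (\<lambda>p. p + sum_list c) ` Poly_Mapping.keys (v (ix i c)))"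
      by (intro UN_I[of c] image_eqI[of _ _ r]) simp_all
  qed
qed (auto simp: finite_chains)

lemma in_image_dmapI:
  assumes v: "v \<in> free_mod G (rk i)"
    and y: "\<And>s. \<exists>y. supp_on (chains_at (Suc i) s) y \<and> (\<forall>c\<in>chains i. bd i (m (Suc i)) y c = comp i s v c)"
  shows "v \<in> dmap i ` free_mod G (rk (Suc i))"
proof -
  \<comment> \<open>Choosing the zero preimage wherever the component of \<open>v\<close> vanishes
    keeps the family finitely supported, as \<open>comp_surj\<close> requires.\<close>
  have "\<exists>y. supp_on (chains_at (Suc i) s) y \<and> (\<forall>c\<in>chains i. bd i (m (Suc i)) y c = comp i s v c)
      \<and> (comp i s v = (\<lambda>_. 0) \<longrightarrow> y = (\<lambda>_. 0))" for s
  proof (cases "comp i s v = (\<lambda>_. 0)")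
    case True
    then show ?thesis by (intro exI[of _ "\<lambda>_. 0"]) (auto simp: supp_on_def bd_def)
  next
    case False
    then show ?thesis using y[of s] by auto
  qed
  then obtain y where y: "\<And>s. supp_on (chains_at (Suc i) s) (y s)"
    "\<And>s c. c \<in> chains i \<Longrightarrow> bd i (m (Suc i)) (y s) c = comp i s v c"
    "\<And>s. comp i s v = (\<lambda>_. 0) \<Longrightarrow> y s = (\<lambda>_. 0)"
    by metis
  have "finite {s. y s \<noteq> (\<lambda>_. 0)}"
    by (rule finite_subset[OF _ finite_comp_support[OF v]]) (use y(3) in auto)
  from comp_surj[OF y(1) this] obtain w where w: "w \<in> free_mod G (rk (Suc i))"
    "\<And>s c. c \<in> chains (Suc i) \<Longrightarrow> comp (Suc i) s w c = y s c" by blast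
  have "v = dmap i w"
  proof (rule comp_eqI[OF v dmap_free_mod[OF w(1)]])
    fix s c assume c: "c \<in> chains i"
    have "bd i (m (Suc i)) (comp (Suc i) s w) c = bd i (m (Suc i)) (y s) c"
      by (rule bd_cong) (simp add: w(2))
    then show "comp i s v c = comp i s (dmap i w) c"
      by (simp add: comp_dmap[OF w(1) c] y(2)[OF c])
  qed
  then show ?thesis using w(1) by blast
qed

lemma comp_0_0: "comp 0 0 v [] = Poly_Mapping.lookup (v 0) 0"
proof -
  have nil: "[] \<in> chains 0" by (simp add: chains_0)
  then have "ix 0 [] = 0" using ix_less[OF nil] by (simp add: rk_0)
  moreover have "[] \<in> chains_at 0 0"
    using nil by (auto simp: chains_at_def intro: bexI[of _ 0])
  ultimately show ?thesis by (simp add: comp_def)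
qed

lemma chains_at_Suc_0: "chains_at (Suc i) 0 = {}"
proof (rule ccontr)
  assume "chains_at (Suc i) 0 \<noteq> {}"
  then obtain c where c: "c \<in> chains_at (Suc i) 0" by auto
  then obtain r where r: "r \<in> semigrp G" "0 = r + sum_list c" "c \<in> chains (Suc i)"
    by (elim chains_atE)
  have "length (nf r @ c) = length ([] :: expv list)"
    using r nf_set[OF r(1)] nf_sum[OF r(1)] by (intro length_eq) (auto simp: chains_def)
  then show False using r(3) by (simp add: chains_def)
qed

text \<open>The constant term is the component in multidegree 0. There
  \<open>chains_at (Suc 0) 0\<close> is empty, so images have constant term 0; in any other
  multidegree every element is a cycle and hence a boundary.\<close>

lemma exact_at_0:
  "{v \<in> free_mod G (rk 0). Poly_Mapping.lookup (v 0) 0 = 0} = dmap 0 ` free_mod G (rk (Suc 0))"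
proof (intro equalityI subsetI)
  fix v :: "nat \<Rightarrow> 'k tpoly"
  assume v: "v \<in> {v \<in> free_mod G (rk 0). Poly_Mapping.lookup (v 0) 0 = 0}"
  show "v \<in> dmap 0 ` free_mod G (rk (Suc 0))"
  proof (rule in_image_dmapI)
    fix s
    show "\<exists>y. supp_on (chains_at (Suc 0) s) y \<and> (\<forall>c\<in>chains 0. bd 0 (m (Suc 0)) y c = comp 0 s v c)"
    proof (cases "s = 0")
      case True
      then show ?thesis
        using v comp_0_0[of v]
        by (intro exI[of _ "\<lambda>_. 0"]) (auto simp: supp_on_def bd_def chains_0)
    next
      case False
      then have "cycle 0 (m 0) s (comp 0 s v)"
        by (simp add: cycle_def supp_on_comp)
      then show ?thesis
        by (rule exactness_unbounded[OF m_step m_tri])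
    qed
  qed (use v in auto)
next
  fix v assume "v \<in> dmap 0 ` free_mod G (rk (Suc 0))"
  then obtain w where w: "w \<in> free_mod G (rk (Suc 0))" "v = dmap 0 w" by auto
  have nil: "[] \<in> chains 0" by (simp add: chains_0)
  have "comp (Suc 0) 0 w = (\<lambda>_. 0)" by (auto simp: comp_def chains_at_Suc_0)
  then have "comp 0 0 v [] = 0"
    by (simp add: w(2) comp_dmap[OF w(1) nil] bd_def)
  then show "v \<in> {v \<in> free_mod G (rk 0). Poly_Mapping.lookup (v 0) 0 = 0}"
    using comp_0_0[of v] dmap_free_mod[OF w(1)] w(2) by simp
qed

lemma exact_at_Suc:
  "{v \<in> free_mod G (rk (Suc j)). dmap j v = (\<lambda>_. 0)} = dmap (Suc j) ` free_mod G (rk (Suc (Suc j)))"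
proof (intro equalityI subsetI)
  fix v assume v: "v \<in> {v \<in> free_mod G (rk (Suc j)). dmap j v = (\<lambda>_. 0)}"
  show "v \<in> dmap (Suc j) ` free_mod G (rk (Suc (Suc j)))"
  proof (rule in_image_dmapI)
    fix s
    have "bd j (m (Suc j)) (comp (Suc j) s v) c = 0" if "c \<in> chains j" for c
    proof -
      have "bd j (m (Suc j)) (comp (Suc j) s v) c = comp j s (dmap j v) c"
        using v that comp_dmap[of v j c s] by auto
      then show ?thesis using v by (simp add: comp_def)
    qed
    then have "cycle (Suc j) (m (Suc j)) s (comp (Suc j) s v)"
      by (simp add: cycle_def supp_on_comp)
    then show "\<exists>y. supp_on (chains_at (Suc (Suc j)) s) y \<and>
        (\<forall>c\<in>chains (Suc j). bd (Suc j) (m (Suc (Suc j))) y c = comp (Suc j) s v c)"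
      by (rule exactness_unbounded[OF m_step m_tri])
  qed (use v in auto)
next
  fix v assume "v \<in> dmap (Suc j) ` free_mod G (rk (Suc (Suc j)))"
  then obtain w where w: "w \<in> free_mod G (rk (Suc (Suc j)))" "v = dmap (Suc j) w" by auto
  have vf: "v \<in> free_mod G (rk (Suc j))" using dmap_free_mod[OF w(1)] w(2) by simp
  have "dmap j v = (\<lambda>_. 0)"
  proof (rule comp_eqI[OF dmap_free_mod[OF vf]])
    show "(\<lambda>_. 0) \<in> free_mod G (rk j)" by (simp add: free_mod_def semigroup_ring_def)
    fix s c assume c: "c \<in> chains j"
    have "bd j (m (Suc j)) (comp (Suc j) s v) c
        = bd j (m (Suc j)) (bd (Suc j) (m (Suc (Suc j))) (comp (Suc (Suc j)) s w)) c"
      by (rule bd_cong) (simp add: w(2) comp_dmap[OF w(1)])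
    also have "\<dots> = 0" by (rule bd_bd[OF m_step c])
    finally show "comp j s (dmap j v) c = comp j s (\<lambda>_. 0) c"
      by (simp add: comp_dmap[OF vf c]) (simp add: comp_def)
  qed
  then show "v \<in> {v \<in> free_mod G (rk (Suc j)). dmap j v = (\<lambda>_. 0)}" using vf by simp
qed

lemma koszul_of_resolution: "koszul G TYPE('k)"
  unfolding koszul_def
proof (intro exI[of _ rk] exI[of _ dmat] conjI allI impI)
  fix i r c :: nat
  assume "1 \<le> i" "r < rk (i - 1)" "c < rk i"
  then show "dmat i r c \<in> semigroup_ring_deg1 G"
    using dmat_linear[of r "i - 1" c] by simp
next
  show "{v \<in> free_mod G (rk 0). Poly_Mapping.lookup (v 0) 0 = 0}
      = mat_app (rk 0) (rk 1) (dmat 1) ` free_mod G (rk 1)"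
    using exact_at_0 by simp
next
  fix i :: nat assume "1 \<le> i"
  then show "{v \<in> free_mod G (rk i). mat_app (rk (i - 1)) (rk i) (dmat i) v = (\<lambda>_. 0)}
      = mat_app (rk i) (rk (i + 1)) (dmat (i + 1)) ` free_mod G (rk (i + 1))"
    using exact_at_Suc[of "i - 1"] by simp
qed (rule rk_0)

end

context pbw_set
begin

theorem koszul: "koszul G TYPE('k::field)"
proof -
  obtain m :: "nat \<Rightarrow> expv list \<Rightarrow> expv list \<Rightarrow> 'k" where
    m: "\<And>i. triangular i (m (Suc i))" "\<And>i. complex_step i (m i) (m (Suc i))"
    using ex_differentials by blast
  have "\<exists>e. bij_betw e {..<card (chains i)} (chains i)" for i
    using ex_bij_betw_nat_finite[OF finite_chains] by (simp add: lessThan_atLeast0)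
  then obtain en where "\<And>i. bij_betw (en i) {..<card (chains i)} (chains i)"
    by metis
  then interpret pbw_resolution G m en
    using m by unfold_locales
  show ?thesis by (rule koszul_of_resolution)
qed

end

section \<open>The Groebner basis\<close>

text \<open>Identifies the order of the statement with the linear order of the type
  \<open>expv\<close>, so that words carry the lexicographic list order.\<close>

lemma lex_less_iff: "lex_less b c \<longleftrightarrow> b < c"
  by (auto simp: lex_less_def less_poly_mapping.rep_eq less_fun_def)

lemma lex_le_iff: "lex_le b c \<longleftrightarrow> b \<le> c"
  by (auto simp: lex_le_def lex_less_iff)

lemma grevlex_less_trans:
  assumes "grevlex_less p q" "grevlex_less q r"
  shows "grevlex_less p r"
proof (cases "mdeg p = mdeg q \<and> mdeg q = mdeg r")
  case False
  then show ?thesis using assms by (auto simp: grevlex_less_def)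
next
  case True
  obtain b where b: "Poly_Mapping.lookup q b < Poly_Mapping.lookup p b"
      "\<And>g. b < g \<Longrightarrow> Poly_Mapping.lookup p g = Poly_Mapping.lookup q g"
    using assms(1) True by (auto simp: grevlex_less_def lex_less_iff)
  obtain c where c: "Poly_Mapping.lookup r c < Poly_Mapping.lookup q c"
      "\<And>g. c < g \<Longrightarrow> Poly_Mapping.lookup q g = Poly_Mapping.lookup r g"
    using assms(2) True by (auto simp: grevlex_less_def lex_less_iff)
  have "Poly_Mapping.lookup r (max b c) < Poly_Mapping.lookup p (max b c)"
    using b c by (cases b c rule: linorder_cases) (auto simp: max_def)
  moreover have "\<forall>g. max b c < g \<longrightarrow> Poly_Mapping.lookup p g = Poly_Mapping.lookup r g"
    using b(2) c(2) by auto
  ultimately show ?thesis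
    using True by (auto simp: grevlex_less_def lex_less_iff)
qed

lemma grevlex_less_irrefl: "\<not> grevlex_less p p"
  by (simp add: grevlex_less_def)

lemma grevlex_less_total:
  assumes "p \<noteq> q"
  shows "grevlex_less p q \<or> grevlex_less q p"
proof (cases "mdeg p = mdeg q")
  case True
  define D where "D = {b. Poly_Mapping.lookup p b \<noteq> Poly_Mapping.lookup q b}"
  have "D \<subseteq> Poly_Mapping.keys p \<union> Poly_Mapping.keys q"
    by (auto simp: D_def in_keys_iff)
  then have fin: "finite D" by (rule finite_subset) simp
  have ne: "D \<noteq> {}" using assms by (auto simp: D_def poly_mapping_eq_iff fun_eq_iff)
  have "Max D \<in> D" using fin ne by simp
  moreover have "\<forall>g. Max D < g \<longrightarrow> Poly_Mapping.lookup p g = Poly_Mapping.lookup q g"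
  proof (intro allI impI, rule ccontr)
    fix g assume "Max D < g" "Poly_Mapping.lookup p g \<noteq> Poly_Mapping.lookup q g"
    then show False using Max_ge[OF fin, of g] by (simp add: D_def)
  qed
  ultimately show ?thesis
    using True unfolding grevlex_less_def lex_less_iff D_def
    by (metis (mono_tags, lifting) linorder_neqE_nat mem_Collect_eq)
qed (auto simp: grevlex_less_def)

section \<open>Degrees and images of monomials; monomials as sorted words\<close>

lemma sum_keys_superset:
  assumes "finite A" "Poly_Mapping.keys p \<subseteq> A" "\<And>a. f a 0 = (0::nat)"
  shows "(\<Sum>a\<in>Poly_Mapping.keys p. f a (Poly_Mapping.lookup p a)) = (\<Sum>a\<in>A. f a (Poly_Mapping.lookup p a))"
  using assms by (intro sum.mono_neutral_left) (auto simp: in_keys_iff)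

lemma mdeg_add: "mdeg (p + q) = mdeg p + mdeg q"
proof -
  let ?A = "Poly_Mapping.keys p \<union> Poly_Mapping.keys q"
  have "mdeg r = (\<Sum>a\<in>?A. Poly_Mapping.lookup r a)" if "Poly_Mapping.keys r \<subseteq> ?A" for r
    unfolding mdeg_def using sum_keys_superset[of ?A r "\<lambda>_ k. k"] that by simp
  then show ?thesis
    using keys_add[of p q] by (simp add: lookup_add sum.distrib)
qed

lemma lookup_mon_img:
  "Poly_Mapping.lookup (mon_img p) i = (\<Sum>a\<in>Poly_Mapping.keys p. Poly_Mapping.lookup p a * Poly_Mapping.lookup a i)"
  unfolding mon_img_def lookup_sum
  by (rule sum.cong) (auto simp: Poly_Mapping.map.rep_eq when_def)

lemma mon_img_add: "mon_img (p + q) = mon_img p + mon_img q"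
proof (rule poly_mapping_eqI)
  fix i
  let ?A = "Poly_Mapping.keys p \<union> Poly_Mapping.keys q"
  have "Poly_Mapping.lookup (mon_img r) i = (\<Sum>a\<in>?A. Poly_Mapping.lookup r a * Poly_Mapping.lookup a i)"
    if "Poly_Mapping.keys r \<subseteq> ?A" for r
    unfolding lookup_mon_img
    using sum_keys_superset[of ?A r "\<lambda>a k. k * Poly_Mapping.lookup a i"] that by simp
  then show "Poly_Mapping.lookup (mon_img (p + q)) i = Poly_Mapping.lookup (mon_img p + mon_img q) i"
    using keys_add[of p q] by (simp add: lookup_add sum.distrib distrib_right)
qed

lemma grevlex_less_add:
  assumes "grevlex_less p q"
  shows "grevlex_less (r + p) (r + q)"
  using assms by (auto simp: grevlex_less_def mdeg_add lookup_add)

definition mon_of :: "expv list \<Rightarrow> smon" where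
  "mon_of l = (\<Sum>a\<leftarrow>l. Poly_Mapping.single a 1)"

lemma mon_of_simps [simp]:
  "mon_of [] = 0"
  "mon_of (a # l) = Poly_Mapping.single a 1 + mon_of l"
  "mon_of (l @ l') = mon_of l + mon_of l'"
  by (simp_all add: mon_of_def)

lemma mon_img_mon_of: "mon_img (mon_of l) = sum_list l"
proof (induction l)
  case (Cons a l)
  have "mon_img (Poly_Mapping.single a 1) = a"
    by (rule poly_mapping_eqI) (simp add: lookup_mon_img)
  then show ?case using Cons by (simp add: mon_img_add)
qed (simp add: mon_img_def)

lemma mdeg_mon_of: "mdeg (mon_of l) = length l"
proof (induction l)
  case (Cons a l)
  have "mdeg (Poly_Mapping.single a 1) = 1" by (simp add: mdeg_def)
  then show ?case using Cons by (simp add: mdeg_add)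
qed (simp add: mdeg_def)

lemma keys_mon_of: "Poly_Mapping.keys (mon_of l) = set l"
proof (induction l)
  case (Cons a l)
  then show ?case
    by (auto simp: in_keys_iff lookup_add lookup_single when_def set_eq_iff split: if_splits)
qed simp

lemma mon_of_sort: "mon_of (sort l) = mon_of l"
proof (induction l)
  case (Cons a l)
  have "mon_of (insort a xs) = Poly_Mapping.single a 1 + mon_of xs" for xs
    by (induction xs) (auto simp: ac_simps)
  then show ?case using Cons by simp
qed simp

lemma ex_sorted_word: "\<exists>l. sorted l \<and> mon_of l = p"
proof -
  have "\<exists>l. mon_of l = p"
  proof (induction "mdeg p" arbitrary: p)
    case 0
    have "Poly_Mapping.keys p = {}"
    proof (rule ccontr)
      assume "Poly_Mapping.keys p \<noteq> {}"
      then obtain a where "a \<in> Poly_Mapping.keys p" by blast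
      then have "Poly_Mapping.lookup p a = 0" using 0 by (simp add: mdeg_def)
      then show False using \<open>a \<in> Poly_Mapping.keys p\<close> by (simp add: in_keys_iff)
    qed
    then show ?case by (intro exI[of _ "[]"]) simp
  next
    case (Suc k)
    then have "Poly_Mapping.keys p \<noteq> {}" by (auto simp: mdeg_def)
    then obtain a where a: "Poly_Mapping.lookup p a \<noteq> 0" by (metis ex_in_conv in_keys_iff)
    have p: "p = Poly_Mapping.single a 1 + (p - Poly_Mapping.single a 1)"
      by (rule poly_mapping_eqI) (use a in \<open>auto simp: lookup_add lookup_minus lookup_single when_def\<close>)
    have "mdeg (Poly_Mapping.single a 1) = 1" by (simp add: mdeg_def)
    then have "mdeg (p - Poly_Mapping.single a 1) = k"
      using Suc(2) mdeg_add[of "Poly_Mapping.single a 1" "p - Poly_Mapping.single a 1"] p by simp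
    then obtain l where "mon_of l = p - Poly_Mapping.single a 1" using Suc(1) by metis
    then have "mon_of (a # l) = p" using p by simp
    then show ?case by blast
  qed
  then obtain l where "mon_of l = p" by blast
  then have "mon_of (sort l) = p" by (simp add: mon_of_sort)
  then show ?thesis by (intro exI[of _ "sort l"]) simp
qed

lemma lead_mon_eqI:
  assumes "p \<in> Poly_Mapping.keys f" "\<And>q. q \<in> Poly_Mapping.keys f \<Longrightarrow> q \<noteq> p \<Longrightarrow> grevlex_less q p"
  shows "lead_mon f = p"
  unfolding lead_mon_def
proof (rule the_equality)
  fix q assume q: "q \<in> Poly_Mapping.keys f \<and> (\<forall>r\<in>Poly_Mapping.keys f. r \<noteq> q \<longrightarrow> grevlex_less r q)"
  show "q = p"
  proof (rule ccontr)
    assume "q \<noteq> p"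
    then have "grevlex_less q p" "grevlex_less p q" using assms q by auto
    then show False using grevlex_less_trans grevlex_less_irrefl by blast
  qed
qed (use assms in auto)

lemma lead_mon:
  assumes "f \<noteq> 0"
  shows "lead_mon f \<in> Poly_Mapping.keys f"
    and "q \<in> Poly_Mapping.keys f \<Longrightarrow> q \<noteq> lead_mon f \<Longrightarrow> grevlex_less q (lead_mon f)"
proof -
  have "\<exists>p \<in> Poly_Mapping.keys f. \<forall>q \<in> Poly_Mapping.keys f. q \<noteq> p \<longrightarrow> grevlex_less q p"
  proof (rule Finite_Set.bex_greatest_element)
    show "transp_on (Poly_Mapping.keys f) grevlex_less"
      by (rule transp_onI) (rule grevlex_less_trans)
    show "totalp_on (Poly_Mapping.keys f) grevlex_less"
      by (rule totalp_onI) (rule grevlex_less_total)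
  qed (use assms in auto)
  then obtain p where p: "p \<in> Poly_Mapping.keys f"
    "\<And>q. q \<in> Poly_Mapping.keys f \<Longrightarrow> q \<noteq> p \<Longrightarrow> grevlex_less q p" by blast
  then have "lead_mon f = p" by (rule lead_mon_eqI)
  with p show "lead_mon f \<in> Poly_Mapping.keys f"
    "q \<in> Poly_Mapping.keys f \<Longrightarrow> q \<noteq> lead_mon f \<Longrightarrow> grevlex_less q (lead_mon f)" by auto
qed

lemma Sring_mult:
  assumes "p \<in> Sring G" "q \<in> Sring G"
  shows "p * q \<in> Sring G"
  unfolding Sring_def
proof (intro CollectI ballI)
  fix r assume "r \<in> Poly_Mapping.keys (p * q)"
  then obtain a b where "r = a + b" "a \<in> Poly_Mapping.keys p" "b \<in> Poly_Mapping.keys q"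
    using keys_mult[of p q] by blast
  then show "Poly_Mapping.keys r \<subseteq> G"
    using assms keys_add[of a b] unfolding Sring_def by blast
qed

lemma Sring_sum:
  assumes "\<And>j. j \<in> J \<Longrightarrow> f j \<in> Sring G"
  shows "sum f J \<in> Sring G"
  using assms
proof (induction J rule: infinite_finite_induct)
  case (insert j J)
  then have "f j \<in> Sring G" "sum f J \<in> Sring G" by auto
  then show ?case
    using insert keys_add[of "f j" "sum f J"] unfolding Sring_def by fastforce
qed (auto simp: Sring_def)

lemma ideal_gen_subset:
  assumes "\<And>a. a \<in> A \<Longrightarrow> \<exists>q\<in>Sring G. \<exists>b\<in>B. a = q * b"
  shows "ideal_gen G A \<subseteq> ideal_gen G B"
proof
  fix f assume "f \<in> ideal_gen G A"
  then obtain F c where F: "finite F" "F \<subseteq> A" "\<And>g. g \<in> F \<Longrightarrow> c g \<in> Sring G" "f = (\<Sum>g\<in>F. c g * g)"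
    by (auto simp: ideal_gen_def)
  obtain q b where qb: "\<And>a. a \<in> A \<Longrightarrow> q a \<in> Sring G \<and> b a \<in> B \<and> a = q a * b a"
    using assms by metis
  \<comment> \<open>Several elements of \<open>F\<close> may be multiples of the same generator,
    while \<open>ideal_gen\<close> allows one coefficient per generator; hence the sum over the
    fibre of \<open>b\<close>.\<close>
  define c' where "c' h = (\<Sum>g\<in>{g\<in>F. b g = h}. c g * q g)" for h
  have "f = (\<Sum>g\<in>F. c g * q g * b g)"
    unfolding F(4)
  proof (rule sum.cong[OF refl])
    fix g assume "g \<in> F"
    then have "g = q g * b g" using qb F(2) by blast
    then show "c g * g = c g * q g * b g" by (metis mult.assoc)
  qed
  also have "\<dots> = (\<Sum>h\<in>b ` F. \<Sum>g\<in>{g\<in>F. b g = h}. c g * q g * b g)"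
    by (rule sum.image_gen[OF F(1)])
  also have "\<dots> = (\<Sum>h\<in>b ` F. c' h * h)"
    unfolding c'_def sum_distrib_right by (intro sum.cong) auto
  finally have "f = (\<Sum>h\<in>b ` F. c' h * h)" .
  moreover have "\<forall>h\<in>b ` F. c' h \<in> Sring G"
    unfolding c'_def using F(2,3) qb by (auto intro!: Sring_sum Sring_mult)
  ultimately show "f \<in> ideal_gen G B"
    using F(1,2) qb unfolding ideal_gen_def
    by (intro CollectI exI[of _ "b ` F"] exI[of _ c']) auto
qed

lemma lookup_toric_map:
  "Poly_Mapping.lookup (toric_map f) s = (\<Sum>p\<in>Poly_Mapping.keys f. Poly_Mapping.lookup f p when mon_img p = s)"
  by (simp add: toric_map_def lookup_sum lookup_single)

lemma var_mult: "var a * var b = Poly_Mapping.single (mon_of [a, b]) 1"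
  by (simp add: var_def mult_single)

lemma keys_binomial:
  assumes "p \<noteq> q"
  shows "Poly_Mapping.keys (Poly_Mapping.single p 1 - Poly_Mapping.single q (1::'k::field)) = {p, q}"
  using assms by (auto simp: in_keys_iff lookup_minus lookup_single when_def split: if_splits)

lemma binomial_toric:
  assumes "p \<noteq> q" "mon_img p = mon_img q"
  shows "toric_map (Poly_Mapping.single p 1 - Poly_Mapping.single q (1::'k::field)) = 0"
  using assms by (simp add: toric_map_def keys_binomial lookup_minus lookup_single flip: single_add)

lemma not_std_wordE:
  assumes "set l \<subseteq> G" "\<not> std_word G l"
  obtains xs a b ys where "l = xs @ a # b # ys" "\<not> std_pair G a b"
proof -
  obtain i where i: "Suc i < length l" "\<not> std_pair G (l ! i) (l ! Suc i)"
    using assms by (auto simp: std_word_def successively_conv_nth)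
  have "l = take i l @ l ! i # l ! Suc i # drop (Suc (Suc i)) l"
    using i by (simp add: Cons_nth_drop_Suc)
  then show thesis using that i(2) by blast
qed

section \<open>Straightening binomials and their leading monomials\<close>

context pbw_set
begin

definition straightenings :: "'k::field spoly set" where
  "straightenings = {var \<alpha> * var \<beta> - var \<gamma> * var \<delta> | \<alpha> \<beta> \<gamma> \<delta>. \<alpha> \<in> G \<and> \<beta> \<in> G \<and> \<alpha> \<le> \<beta> \<and>
     \<not> std_pair G \<alpha> \<beta> \<and> std_pair G \<gamma> \<delta> \<and> \<gamma> + \<delta> = \<alpha> + \<beta>}"

lemma ex_std_pair:
  assumes "a \<in> G" "b \<in> G"
  obtains c d where "std_pair G c d" "c + d = a + b"
proof -
  have "set [a, b] \<subseteq> G" using assms by simp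
  then have len: "length (nf (a + b)) = 2" and std: "std_word G (nf (a + b))" and sum: "sum_list (nf (a + b)) = a + b"
    using length_nf[of "[a, b]"] nf_std[of "a + b"] nf_sum[of "a + b"] sum_list_in_semigrp[of "[a, b]"]
    by simp_all
  then obtain c d where "nf (a + b) = [c, d]"
    by (auto simp: numeral_2_eq_2 length_Suc_conv)
  then show thesis using that[of c d] std sum by (simp add: std_word_def)
qed

text \<open>Since the sums agree, \<open>c < a\<close> forces \<open>b < d\<close>. So
  \<open>d\<close> is the largest of the four letters, that is, the smallest variable, and it occurs
  only in the monomial of \<open>[c, d]\<close>, which is therefore the smaller one.\<close>

lemma straightening_less:
  assumes "a \<in> G" "b \<in> G" "a \<le> b" "\<not> std_pair G a b" "std_pair G c d" "c + d = a + b"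
  shows "grevlex_less (mon_of [c, d]) (mon_of [a, b])"
proof -
  have "c \<le> a" using assms by (auto simp: std_pair_def)
  moreover have "c \<noteq> a" using assms by auto
  ultimately have "c < a" by simp
  have "b < d"
  proof (rule ccontr)
    assume "\<not> b < d"
    then have "c + d < a + b" using \<open>c < a\<close> by (simp add: add_less_le_mono)
    then show False using assms(6) by simp
  qed
  have z: "Poly_Mapping.lookup (mon_of [a, b]) g = 0" if "d \<le> g" for g
    using that \<open>b < d\<close> assms(3) by (auto simp: lookup_add lookup_single when_def)
  have "Poly_Mapping.lookup (mon_of [c, d]) g = 0" if "d < g" for g
    using that \<open>b < d\<close> assms(3) \<open>c < a\<close> by (auto simp: lookup_add lookup_single when_def)
  moreover have "Poly_Mapping.lookup (mon_of [c, d]) d > 0"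
    by (simp add: lookup_add)
  ultimately have "Poly_Mapping.lookup (mon_of [a, b]) d < Poly_Mapping.lookup (mon_of [c, d]) d \<and>
      (\<forall>g. d < g \<longrightarrow> Poly_Mapping.lookup (mon_of [c, d]) g = Poly_Mapping.lookup (mon_of [a, b]) g)"
    using z by (metis order_less_imp_le order_refl)
  moreover have "mdeg (mon_of [c, d]) = mdeg (mon_of [a, b])"
    unfolding mdeg_mon_of by simp
  ultimately show ?thesis
    unfolding grevlex_less_def lex_less_iff by blast
qed

lemma straightening_props:
  fixes f :: "'k::field spoly"
  assumes "a \<in> G" "b \<in> G" "a \<le> b" "\<not> std_pair G a b" "std_pair G c d" "c + d = a + b"
    and f: "f = var a * var b - var c * var d"
  shows "f \<in> toric_ideal G" "f \<noteq> 0" "lead_mon f = mon_of [a, b]"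
proof -
  have less: "grevlex_less (mon_of [c, d]) (mon_of [a, b])"
    using straightening_less assms(1-6) .
  then have ne: "mon_of [a, b] \<noteq> mon_of [c, d]" using grevlex_less_irrefl by metis
  have f': "f = Poly_Mapping.single (mon_of [a, b]) 1 - Poly_Mapping.single (mon_of [c, d]) 1"
    by (simp only: f var_mult)
  have keys: "Poly_Mapping.keys f = {mon_of [a, b], mon_of [c, d]}"
    unfolding f' by (rule keys_binomial[OF ne])
  have "c \<in> G" "d \<in> G" using assms(5) by (auto simp: std_pair_def)
  then have "f \<in> Sring G"
    using assms(1,2) by (auto simp: Sring_def keys keys_mon_of simp del: mon_of_simps)
  moreover have "toric_map f = 0"
    unfolding f' by (rule binomial_toric[OF ne]) (simp add: mon_img_mon_of assms(6) del: mon_of_simps)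
  ultimately show "f \<in> toric_ideal G" by (simp add: toric_ideal_def)
  show "f \<noteq> 0" using keys by auto
  show "lead_mon f = mon_of [a, b]"
    by (rule lead_mon_eqI) (use less in \<open>auto simp: keys simp del: mon_of_simps\<close>)
qed

lemma fibre_finite: "finite {p. Poly_Mapping.keys p \<subseteq> G \<and> mon_img p = s}"
proof (rule finite_subset)
  show "{p. Poly_Mapping.keys p \<subseteq> G \<and> mon_img p = s} \<subseteq> mon_of ` words s"
  proof
    fix p assume p: "p \<in> {p. Poly_Mapping.keys p \<subseteq> G \<and> mon_img p = s}"
    obtain l where "mon_of l = p" using ex_sorted_word by blast
    with p show "p \<in> mon_of ` words s"
      by (auto simp: words_def keys_mon_of mon_img_mon_of)
  qed
qed (simp add: finite_words)

text \<open>A grevlex-minimal monomial of the finite fibre has a standard sorted word, since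
  otherwise straightening a consecutive pair would give a smaller monomial of the same fibre. By
  uniqueness that word is \<open>l\<close>.\<close>

lemma std_word_grevlex_least:
  assumes l: "std_word G l" and p: "Poly_Mapping.keys p \<subseteq> G" "mon_img p = sum_list l"
  shows "\<not> grevlex_less p (mon_of l)"
proof -
  let ?S = "{p. Poly_Mapping.keys p \<subseteq> G \<and> mon_img p = sum_list l}"
  have "\<exists>p0\<in>?S. \<forall>x\<in>?S. x \<noteq> p0 \<longrightarrow> \<not> grevlex_less x p0"
  proof (rule Finite_Set.bex_min_element[OF fibre_finite])
    show "asymp_on ?S grevlex_less"
      using grevlex_less_trans grevlex_less_irrefl by (intro asymp_onI) blast
    show "transp_on ?S grevlex_less"
      by (rule transp_onI) (rule grevlex_less_trans)
  qed (use p in auto)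
  then obtain p0 where p0: "Poly_Mapping.keys p0 \<subseteq> G" "mon_img p0 = sum_list l"
    and p0_min: "\<forall>x\<in>?S. x \<noteq> p0 \<longrightarrow> \<not> grevlex_less x p0"
    by auto
  have min: "\<not> grevlex_less x p0" if "Poly_Mapping.keys x \<subseteq> G" "mon_img x = sum_list l" for x
    using p0_min that grevlex_less_irrefl[of p0] by (cases "x = p0") auto
  obtain l0 where l0: "sorted l0" "mon_of l0 = p0" using ex_sorted_word by blast
  have l0G: "set l0 \<subseteq> G" and l0s: "sum_list l0 = sum_list l"
    using l0 p0 keys_mon_of mon_img_mon_of by metis+
  have "std_word G l0"
  proof (rule ccontr)
    assume "\<not> std_word G l0"
    then obtain xs a b ys where dec: "l0 = xs @ a # b # ys" "\<not> std_pair G a b"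
      by (rule not_std_wordE[OF l0G])
    have ab: "a \<in> G" "b \<in> G" "a \<le> b" using dec l0(1) l0G by (auto simp: sorted_append)
    obtain c d where cd: "std_pair G c d" "c + d = a + b" using ex_std_pair[OF ab(1,2)] .
    let ?x = "mon_of (xs @ ys) + mon_of [c, d]"
    have p0_eq: "p0 = mon_of (xs @ ys) + mon_of [a, b]"
      unfolding l0(2)[symmetric] dec(1) by (simp add: ac_simps)
    have "grevlex_less ?x p0"
      unfolding p0_eq using straightening_less[OF ab dec(2) cd] by (rule grevlex_less_add)
    moreover have x: "?x = mon_of (xs @ c # d # ys)" by (simp add: ac_simps)
    have "Poly_Mapping.keys ?x \<subseteq> G"
      unfolding x keys_mon_of using l0G dec(1) cd(1) by (auto simp: std_pair_def)
    moreover
    have "sum_list (xs @ c # d # ys) = sum_list l"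
    proof -
      have "sum_list (xs @ c # d # ys) = sum_list xs + (c + d) + sum_list ys"
        by (simp add: add.assoc)
      also have "\<dots> = sum_list l0" unfolding cd(2) dec(1) by (simp add: add.assoc)
      finally show ?thesis using l0s by simp
    qed
    then have "mon_img ?x = sum_list l" unfolding x mon_img_mon_of .
    ultimately show False using min by blast
  qed
  then have "l0 = l" using std_word_unique l l0s by blast
  then show ?thesis using min[OF p] l0(2) by simp
qed

text \<open>If the sorted word of the leading monomial were standard, its coefficient would have to
  cancel under \<open>toric_map\<close> against another monomial of the same fibre. That monomial
  would be smaller, against \<open>std_word_grevlex_least\<close>.\<close>

lemma lead_mon_divisible:
  fixes f :: "'k::field spoly"
  assumes f: "f \<in> toric_ideal G" "f \<noteq> 0"
  obtains r a b where "lead_mon f = r + mon_of [a, b]" "Poly_Mapping.keys r \<subseteq> G"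
    "a \<in> G" "b \<in> G" "a \<le> b" "\<not> std_pair G a b"
proof -
  let ?p = "lead_mon f"
  have p: "?p \<in> Poly_Mapping.keys f" using lead_mon(1)[OF f(2)] .
  have keysG: "Poly_Mapping.keys q \<subseteq> G" if "q \<in> Poly_Mapping.keys f" for q
    using f(1) that by (auto simp: toric_ideal_def Sring_def)
  obtain l where l: "sorted l" "mon_of l = ?p" using ex_sorted_word by blast
  have lG: "set l \<subseteq> G" using keysG[OF p] keys_mon_of[of l] l(2) by simp
  have ls: "mon_img ?p = sum_list l" using mon_img_mon_of[of l] l(2) by simp
  have "\<not> std_word G l"
  proof
    assume std: "std_word G l"
    have "\<exists>q\<in>Poly_Mapping.keys f. q \<noteq> ?p \<and> mon_img q = mon_img ?p"
    proof (rule ccontr)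
      assume no: "\<not> ?thesis"
      have "Poly_Mapping.lookup (toric_map f) (mon_img ?p)
          = (\<Sum>q\<in>Poly_Mapping.keys f. if q = ?p then Poly_Mapping.lookup f ?p else 0)"
        unfolding lookup_toric_map using no by (intro sum.cong) (auto simp: when_def)
      also have "\<dots> = Poly_Mapping.lookup f ?p" using p by simp
      finally show False using f(1) p by (simp add: toric_ideal_def in_keys_iff)
    qed
    then obtain q where q: "q \<in> Poly_Mapping.keys f" "q \<noteq> ?p" "mon_img q = mon_img ?p" by blast
    have "grevlex_less q ?p" using lead_mon(2)[OF f(2) q(1,2)] .
    then show False
      using std_word_grevlex_least[OF std keysG[OF q(1)]] q(3) ls l(2) by simp
  qed
  then obtain xs a b ys where dec: "l = xs @ a # b # ys" "\<not> std_pair G a b"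
    by (rule not_std_wordE[OF lG])
  show thesis
  proof (rule that[of "mon_of (xs @ ys)" a b])
    show "?p = mon_of (xs @ ys) + mon_of [a, b]"
      unfolding l(2)[symmetric] dec(1) by (simp add: ac_simps)
    show "Poly_Mapping.keys (mon_of (xs @ ys)) \<subseteq> G"
      unfolding keys_mon_of using lG dec(1) by auto
  qed (use lG l(1) dec in \<open>auto simp: sorted_append\<close>)
qed

theorem groebner: "groebner_basis G straightenings (toric_ideal G :: 'k::field spoly set)"
  unfolding groebner_basis_def
proof
  show sub: "straightenings \<subseteq> (toric_ideal G :: 'k spoly set)"
    unfolding straightenings_def using straightening_props(1)[OF _ _ _ _ _ _ refl] by blast
  have one: "1 \<in> (Sring G :: 'k spoly set)" by (simp add: Sring_def)
  show "initial_ideal G (toric_ideal G) = initial_ideal G (straightenings :: 'k spoly set)"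
  proof
    show "initial_ideal G (toric_ideal G) \<subseteq> initial_ideal G (straightenings :: 'k spoly set)"
      unfolding initial_ideal_def
    proof (rule ideal_gen_subset)
      fix g :: "'k spoly"
      assume "g \<in> (\<lambda>f. mono_poly (lead_mon f)) ` (toric_ideal G - {0 :: 'k spoly})"
      then obtain f :: "'k spoly" where f: "f \<in> toric_ideal G" "f \<noteq> 0" "g = mono_poly (lead_mon f)" by auto
      obtain r a b where r: "lead_mon f = r + mon_of [a, b]" "Poly_Mapping.keys r \<subseteq> G"
        and ab: "a \<in> G" "b \<in> G" "a \<le> b" "\<not> std_pair G a b"
        using lead_mon_divisible[OF f(1,2)] .
      obtain c d where cd: "std_pair G c d" "c + d = a + b" using ex_std_pair[OF ab(1,2)] .
      define h :: "'k spoly" where "h = var a * var b - var c * var d"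
      note h = straightening_props[OF ab cd h_def]
      have "h \<in> straightenings - {0}"
        using h(2) ab cd unfolding straightenings_def h_def by blast
      moreover have "g = mono_poly r * mono_poly (lead_mon h)"
        by (simp add: f(3) r(1) h(3) mono_poly_def mult_single del: mon_of_simps)
      moreover have "mono_poly r \<in> (Sring G :: 'k spoly set)"
        using r(2) by (simp add: mono_poly_def Sring_def)
      ultimately show "\<exists>q\<in>Sring G. \<exists>b\<in>(\<lambda>f. mono_poly (lead_mon f)) ` (straightenings - {0 :: 'k spoly}). g = q * b"
        by blast
    qed
    show "initial_ideal G (straightenings :: 'k spoly set) \<subseteq> initial_ideal G (toric_ideal G)"
      unfolding initial_ideal_def
    proof (rule ideal_gen_subset)
      fix g :: "'k spoly"
      assume "g \<in> (\<lambda>f. mono_poly (lead_mon f)) ` (straightenings - {0 :: 'k spoly})"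
      then show "\<exists>q\<in>Sring G. \<exists>b\<in>(\<lambda>f. mono_poly (lead_mon f)) ` (toric_ideal G - {0 :: 'k spoly}). g = q * b"
        using sub one by (intro bexI[of _ 1] bexI[of _ g]) auto
    qed
  qed
qed

end

section \<open>Standard pairs of the pinched Veronese\<close>

abbreviation (input) lkp :: "expv \<Rightarrow> nat \<Rightarrow> nat" where
  "lkp \<equiv> Poly_Mapping.lookup"

text \<open>The greedy condition: for \<open>i < j\<close>, no factor \<open>t_i\<close> of
  \<open>u\<close> can be exchanged for a factor \<open>t_j\<close> of \<open>v\<close>. By
  \<open>move_less\<close>, such an exchange would lower \<open>u\<close>.\<close>

definition above :: "expv \<Rightarrow> expv \<Rightarrow> bool" where
  "above u v \<longleftrightarrow> (\<forall>i j. lkp u i \<noteq> 0 \<longrightarrow> lkp v j \<noteq> 0 \<longrightarrow> j \<le> i)"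

definition move :: "expv \<Rightarrow> nat \<Rightarrow> nat \<Rightarrow> expv" where
  "move u i j = u - Poly_Mapping.single i 1 + Poly_Mapping.single j 1"

lemma lookup_move:
  "i \<noteq> j \<Longrightarrow> lkp (move u i j) k = (if k = i then lkp u i - 1 else if k = j then lkp u j + 1 else lkp u k)"
  by (auto simp: move_def lookup_add lookup_minus lookup_single when_def)

lemma move_add_move:
  assumes "i \<noteq> j" "lkp u i \<noteq> 0" "lkp v j \<noteq> 0"
  shows "move u i j + move v j i = u + v"
  by (rule poly_mapping_eqI) (use assms in \<open>auto simp: lookup_add lookup_move\<close>)

lemma expv_less_iff: "(u :: expv) < v \<longleftrightarrow> (\<exists>k. (\<forall>i<k. lkp u i = lkp v i) \<and> lkp u k < lkp v k)"
  by (simp add: lex_less_def flip: lex_less_iff)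

lemma move_less:
  assumes "i < j" "lkp u i \<noteq> 0"
  shows "move u i j < u"
  unfolding expv_less_iff using assms by (intro exI[of _ i]) (auto simp: lookup_move)

lemma above_sum_list:
  assumes "\<And>v. v \<in> set l \<Longrightarrow> above u v"
  shows "above u (sum_list l)"
  using assms
proof (induction l)
  case (Cons v l)
  then have "above u v" "above u (sum_list l)" by auto
  then show ?case by (auto simp: above_def lookup_add)
qed (simp add: above_def)

text \<open>The coordinates \<open>P\<close> and \<open>Suc P\<close> are the last two of \<open>n = P + 2\<close>.\<close>

locale pinched =
  fixes P d :: nat
  assumes d2: "2 \<le> d" and d3: "d \<noteq> 3"
begin

abbreviation "N \<equiv> Suc P"
abbreviation "VV \<equiv> V (Suc (Suc P)) d"
abbreviation "GG \<equiv> Gamma (Suc (Suc P)) d"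
abbreviation "a \<equiv> avec (Suc (Suc P)) d"

lemma lookup_avec: "lkp a i = (if i = P then 1 else if i = N then d - 1 else 0)"
  by (simp add: avec_def lookup_add lookup_single when_def)

lemma V_iff: "u \<in> VV \<longleftrightarrow> (\<forall>i>N. lkp u i = 0) \<and> (\<Sum>i<P. lkp u i) + lkp u P + lkp u N = d"
  by (fastforce simp: V_def subset_iff in_keys_iff not_less_eq)

lemma V_zero: "u \<in> VV \<Longrightarrow> i > N \<Longrightarrow> lkp u i = 0"
  by (simp add: V_iff)

lemma V_le: "u \<in> VV \<Longrightarrow> lkp u i \<noteq> 0 \<Longrightarrow> i \<le> N"
  using V_zero not_less by blast

lemma V_sum: "u \<in> VV \<Longrightarrow> (\<Sum>i<P. lkp u i) + lkp u P + lkp u N = d"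
  by (simp add: V_iff)

lemma V_top:
  assumes "u \<in> VV" "\<And>i. i < P \<Longrightarrow> lkp u i = 0"
  shows "lkp u P + lkp u N = d"
  using V_sum[OF assms(1)] assms(2) by simp

lemma V_eqI:
  assumes "\<And>i. i < P \<Longrightarrow> lkp u i = lkp v i" "lkp u P = lkp v P" "lkp u N = lkp v N" "u \<in> VV" "v \<in> VV"
  shows "u = v"
proof (rule poly_mapping_eqI)
  fix i
  consider "i < P" | "i = P" | "i = N" | "i > N" by linarith
  then show "lkp u i = lkp v i"
    using assms V_zero by cases auto
qed

lemma avec_V: "a \<in> VV"
  using d2 by (auto simp: V_iff lookup_avec)

lemma move_V:
  assumes u: "u \<in> VV" and i: "lkp u i \<noteq> 0" and j: "j \<le> N" "i \<noteq> j"
  shows "move u i j \<in> VV"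
proof -
  have total: "u \<in> VV \<longleftrightarrow> (\<forall>i>N. lkp u i = 0) \<and> (\<Sum>i<Suc (Suc P). lkp u i) = d" for u
    by (simp add: V_iff)
  have i': "i < Suc (Suc P)" using V_le[OF u i] by simp
  have j': "j < Suc (Suc P)" using j by simp
  have "(\<Sum>k<Suc (Suc P). lkp (move u i j) k) + (\<Sum>k<Suc (Suc P). if k = i then 1 else 0)
      = (\<Sum>k<Suc (Suc P). lkp u k) + (\<Sum>k<Suc (Suc P). if k = j then 1 else 0)"
    unfolding sum.distrib[symmetric] using i j by (intro sum.cong) (auto simp: lookup_move)
  then have "(\<Sum>k<Suc (Suc P). lkp (move u i j) k) = (\<Sum>k<Suc (Suc P). lkp u k)"
    using i' j' by (simp del: sum.lessThan_Suc)
  then show ?thesis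
    using u i' j' j(2) unfolding total by (auto simp: lookup_move)
qed

lemma Gamma_iff: "u \<in> GG \<longleftrightarrow> u \<in> VV \<and> u \<noteq> a"
  by (auto simp: Gamma_def)

text \<open>Minimality within \<open>GG\<close> still allows lexicographically smaller
  factorizations in \<open>VV\<close>, but only those containing the removed vector. The exchange
  arguments below use this form.\<close>

lemma std_pairD:
  assumes "std_pair GG u v" "u' \<in> VV" "v' \<in> VV" "u' + v' = u + v" "u' < u"
  shows "u' = a \<or> v' = a"
proof -
  have "\<not> (u' \<in> GG \<and> v' \<in> GG)"
    using assms unfolding std_pair_def not_le[symmetric] by blast
  then show ?thesis using assms by (auto simp: Gamma_iff)
qed

text \<open>\<open>shapeB\<close> describes \<open>t\<^sub>n\<^sub>-\<^sub>1\<^sup>2 t\<^sub>n\<^bsup>d-2\<^esup>\<close> and \<open>shapeC j\<close> describes \<open>t\<^sub>j t\<^sub>n\<^bsup>d-1\<^esup>\<close>.\<close>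

definition shapeB :: "expv \<Rightarrow> bool" where
  "shapeB u \<longleftrightarrow> lkp u P = 2 \<and> lkp u N = d - 2 \<and> (\<forall>i. i \<noteq> P \<longrightarrow> i \<noteq> N \<longrightarrow> lkp u i = 0)"

definition shapeC :: "nat \<Rightarrow> expv \<Rightarrow> bool" where
  "shapeC j u \<longleftrightarrow> j < P \<and> lkp u j = 1 \<and> lkp u N = d - 1 \<and> (\<forall>i. i \<noteq> j \<longrightarrow> i \<noteq> N \<longrightarrow> lkp u i = 0)"

definition pairB :: "expv \<Rightarrow> expv \<Rightarrow> bool" where
  "pairB u v \<longleftrightarrow> shapeB u \<and> lkp v N = 1"

definition pairC :: "expv \<Rightarrow> expv \<Rightarrow> bool" where
  "pairC u v \<longleftrightarrow> (\<exists>j. shapeC j u \<and> lkp v P = 1 \<and> lkp v N = 0 \<and> (\<forall>i>j. i \<noteq> P \<longrightarrow> lkp v i = 0))"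

text \<open>A relation that contains the standard pairs and is coarse enough to be transitive on
  \<open>GG\<close>.\<close>

definition pairT :: "expv \<Rightarrow> expv \<Rightarrow> bool" where
  "pairT u v \<longleftrightarrow> above u v \<or> pairB u v \<or> pairC u v"

text \<open>If \<open>above\<close> fails, some exchange lowers \<open>u\<close>, so it must run
  into \<open>a\<close>. This leaves two shapes for \<open>u\<close>; the conditions on
  \<open>v\<close> exclude further exchanges that would lower \<open>u\<close> without reaching
  \<open>a\<close>.\<close>

lemma std_pair_imp_pairT:
  assumes std: "std_pair GG u v"
  shows "pairT u v"
proof (cases "above u v")
  case False
  have uv: "u \<in> VV" "v \<in> VV" "u \<noteq> a" "v \<noteq> a"
    using std by (auto simp: std_pair_def Gamma_iff)
  \<comment> \<open>It is the first letter that becomes \<open>a\<close>. Otherwise \<open>i\<close>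
    and \<open>j\<close> are the last two coordinates and \<open>v\<close> is a power of the last
    variable, the least element of \<open>VV\<close>, against \<open>u \<le> v\<close> and
    \<open>u \<noteq> v\<close>.\<close>
  have swap: "move u i j = a" if ij: "i < j" "lkp u i \<noteq> 0" "lkp v j \<noteq> 0" for i j
  proof (rule ccontr)
    assume ne: "move u i j \<noteq> a"
    have jN: "j \<le> N" using V_le[OF uv(2) ij(3)] .
    have "move v j i = a"
      using std_pairD[OF std move_V[OF uv(1) ij(2) jN] move_V[OF uv(2) ij(3)] move_add_move move_less] ij ne jN
      by auto
    then have e: "lkp (move v j i) k = lkp a k" for k by simp
    have "lkp a i \<noteq> 0" using e[of i] ij by (simp add: lookup_move)
    then have "i = P" "j = N" using ij jN by (auto simp: lookup_avec split: if_splits)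
    then have v0: "lkp v k = 0" if "k \<le> P" for k
      using e[of k] e[of P] ij that by (auto simp: lookup_move lookup_avec split: if_splits)
    have "u \<noteq> v" using v0[of P] ij \<open>i = P\<close> by auto
    then have "u < v" using std_pair_le[OF std] by simp
    then obtain k where k: "\<forall>i<k. lkp u i = lkp v i" "lkp u k < lkp v k"
      unfolding expv_less_iff by auto
    then have "k > P" using v0[of k] by (cases "k \<le> P") auto
    then have "lkp u P = 0" using k(1) v0[of P] by simp
    then show False using ij \<open>i = P\<close> by simp
  qed
  obtain i j where ij: "i < j" "lkp u i \<noteq> 0" "lkp v j \<noteq> 0"
    using False by (auto simp: above_def not_le)
  have e: "lkp (move u i j) k = lkp a k" for k using swap[OF ij] by simp
  have "lkp a j \<noteq> 0" using e[of j] ij by (simp add: lookup_move)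
  then consider "j = N" "i = P" | "j = N" "i < P" | "j = P" "i < P"
    using ij(1) by (auto simp: lookup_avec less_Suc_eq split: if_splits)
  then show ?thesis
  proof cases
    case 1
    have uP: "lkp u P = 2" using e[of P] ij 1 by (simp add: lookup_move lookup_avec)
    have uN: "lkp u N = d - 2" using e[of N] 1 d2 by (simp add: lookup_move lookup_avec)
    have u0: "lkp u k = 0" if "k \<noteq> P" "k \<noteq> N" for k
      using e[of k] that 1 by (simp add: lookup_move lookup_avec)
    have "lkp v N = 1"
    proof (rule ccontr)
      assume "lkp v N \<noteq> 1"
      then have vN: "lkp v N \<ge> 2" using ij 1 by simp
      \<comment> \<open>Exchanging twice jumps over \<open>a\<close>: the exponent at
        \<open>P\<close> falls from 2 to 0 in \<open>u\<close> and rises to at least 2 in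
        \<open>v\<close>.\<close>
      define u' where "u' = move (move u P N) P N"
      define v' where "v' = move (move v N P) N P"
      have "u' \<in> VV" "v' \<in> VV"
        unfolding u'_def v'_def using uv uP vN by (auto intro!: move_V simp: lookup_move)
      moreover have "u' + v' = u + v"
        unfolding u'_def v'_def using uP vN by (simp add: move_add_move lookup_move)
      moreover have "u' < u"
      proof -
        have "u' < move u P N" unfolding u'_def by (rule move_less) (simp_all add: lookup_move uP)
        also have "\<dots> < u" by (rule move_less) (simp_all add: uP)
        finally show ?thesis .
      qed
      moreover have "u' \<noteq> a"
        using lookup_avec[of P] by (auto simp: u'_def lookup_move uP dest!: arg_cong[of _ _ "\<lambda>x. lkp x P"])
      moreover have "v' \<noteq> a"
        using lookup_avec[of P] by (auto simp: v'_def lookup_move dest!: arg_cong[of _ _ "\<lambda>x. lkp x P"])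
      ultimately show False using std_pairD[OF std] by blast
    qed
    then show ?thesis using uP uN u0 by (auto simp: pairT_def pairB_def shapeB_def)
  next
    case 2
    \<comment> \<open>So exchanging \<open>P\<close> with \<open>N\<close> would have to give
      \<open>a\<close> as well, although a factor at \<open>i\<close> remains.\<close>
    have "lkp u P = 1" using e[of P] 2 by (simp add: lookup_move lookup_avec)
    then have "move u P N = a" using swap[of P N] ij 2 by simp
    then have "lkp (move u P N) i = lkp a i" by simp
    then show ?thesis using 2 ij by (simp add: lookup_move lookup_avec)
  next
    case 3
    have uP: "lkp u P = 0" using e[of P] 3 by (simp add: lookup_move lookup_avec)
    have ui: "lkp u i = 1" using e[of i] 3 ij by (simp add: lookup_move lookup_avec)
    have uN: "lkp u N = d - 1" using e[of N] 3 by (simp add: lookup_move lookup_avec)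
    have u0: "lkp u k = 0" if "k \<noteq> i" "k \<noteq> N" for k
      using e[of k] that 3 uP by (cases "k = P") (simp_all add: lookup_move lookup_avec)
    have v0: "lkp v k = 0" if "k > i" "k \<noteq> P" for k
    proof (rule ccontr)
      assume "lkp v k \<noteq> 0"
      then have "move u i k = a" using swap[of i k] that ij by simp
      then have "lkp (move u i k) k = lkp a k" by simp
      then show False using that uN 3 by (auto simp: lookup_move lookup_avec split: if_splits)
    qed
    have "lkp v P = 1"
    proof (rule ccontr)
      assume "lkp v P \<noteq> 1"
      then have vP: "lkp v P \<ge> 2" using ij 3 by simp
      have iN: "i \<noteq> N" "i \<noteq> P" "i \<le> N" using 3 by auto
      \<comment> \<open>Factors at \<open>i\<close> and at \<open>N\<close> are both exchanged for
        factors at \<open>P\<close>; the new first letter has exponent 2 there and differs from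
        \<open>a\<close>.\<close>
      define u' where "u' = move (move u i P) N P"
      define v' where "v' = move (move v P i) P N"
      have "u' \<in> VV" "v' \<in> VV"
        unfolding u'_def v'_def using uv uP vP ui uN d2 iN by (auto intro!: move_V simp: lookup_move)
      moreover have "u' + v' = u + v"
        unfolding u'_def v'_def using uP vP ui uN d2 iN by (simp add: move_add_move lookup_move)
      moreover have "u' < u"
        unfolding expv_less_iff
        using 3 ui by (intro exI[of _ i]) (auto simp: u'_def lookup_move)
      moreover have "u' \<noteq> a"
        using lookup_avec[of P] iN by (auto simp: u'_def lookup_move uP dest!: arg_cong[of _ _ "\<lambda>x. lkp x P"])
      moreover have "v' \<noteq> a"
        using lookup_avec[of i] iN by (auto simp: v'_def lookup_move dest!: arg_cong[of _ _ "\<lambda>x. lkp x i"])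
      ultimately show False using std_pairD[OF std] by blast
    qed
    then have "pairC u v"
      unfolding pairC_def shapeC_def using 3 ui uN u0 v0[of N] v0 by (intro exI[of _ i]) auto
    then show ?thesis by (simp add: pairT_def)
  qed
qed (simp add: pairT_def)

lemma above_topI: "u \<in> VV \<Longrightarrow> w \<in> VV \<Longrightarrow> (\<And>i. lkp u i \<noteq> 0 \<Longrightarrow> i \<ge> N) \<Longrightarrow> above u w"
  using V_le unfolding above_def by (meson le_trans)

lemma above_PI:
  assumes "w \<in> VV" "lkp w N = 0" "\<And>i. lkp u i \<noteq> 0 \<Longrightarrow> i \<ge> P"
  shows "above u w"
  unfolding above_def
proof (intro allI impI)
  fix i j assume "lkp u i \<noteq> 0" "lkp w j \<noteq> 0"
  then have "j \<le> N" "j \<noteq> N" "i \<ge> P" using assms V_le by auto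
  then show "j \<le> i" by simp
qed

text \<open>Three of the nine cases are void because the two conditions on the middle letter clash.
  The others give \<open>above u w\<close>, except for one subcase with \<open>d = 2\<close>, which
  gives \<open>pairB u w\<close>.\<close>

lemma pairT_trans:
  assumes u: "u \<in> GG" and v: "v \<in> GG" and w: "w \<in> GG" and uv: "pairT u v" and vw: "pairT v w"
  shows "pairT u w"
proof -
  have V: "u \<in> VV" "v \<in> VV" "w \<in> VV" "u \<noteq> a" using u v w by (auto simp: Gamma_iff)
  consider (AA) "above u v" "above v w" | (AB) "above u v" "pairB v w" | (AC) "above u v" "pairC v w"
    | (BA) "pairB u v" "above v w" | (BB) "pairB u v" "pairB v w" | (BC) "pairB u v" "pairC v w"
    | (CA) "pairC u v" "above v w" | (CB) "pairC u v" "pairB v w" | (CC) "pairC u v" "pairC v w"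
    using uv vw by (auto simp: pairT_def)
  then show ?thesis
  proof cases
    case AA
    have "\<exists>i. lkp v i \<noteq> 0"
    proof (rule ccontr)
      assume "\<not> ?thesis"
      then show False using V_sum[OF V(2)] d2 by simp
    qed
    then have "above u w" using AA unfolding above_def by (meson le_trans)
    then show ?thesis by (simp add: pairT_def)
  next
    case AB
    show ?thesis
    proof (cases "d = 2")
      case False
      then have "lkp v N \<noteq> 0" using AB(2) d2 by (simp add: pairB_def shapeB_def)
      then have "above u w" using AB(1) V by (intro above_topI) (auto simp: above_def)
      then show ?thesis by (simp add: pairT_def)
    next
      \<comment> \<open>The middle letter is now the square of the variable at \<open>P\<close>, so
        \<open>u\<close> involves only the last two variables; \<open>u \<noteq> a\<close> excludes
        their product.\<close>
      case True
      have "lkp v P \<noteq> 0" using AB(2) by (simp add: pairB_def shapeB_def)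
      then have up: "i \<ge> P" if "lkp u i \<noteq> 0" for i using AB(1) that by (auto simp: above_def)
      then have u0: "lkp u i = 0" if "i < P" for i using that leD by blast
      have top: "lkp u P + lkp u N = d" using V_top[OF V(1) u0] .
      have "lkp u P \<noteq> 1"
      proof
        assume "lkp u P = 1"
        then have "u = a" using top u0 V(1) avec_V
          by (intro V_eqI) (auto simp: lookup_avec)
        then show False using V(4) by simp
      qed
      then consider "lkp u P = 0" | "lkp u P = 2" "lkp u N = 0" using top True by fastforce
      then show ?thesis
      proof cases
        case 1
        then have "i \<ge> N" if "lkp u i \<noteq> 0" for i using up[OF that] that by (cases "i = P") auto
        then have "above u w" using V by (intro above_topI)
        then show ?thesis by (simp add: pairT_def)
      next
        case 2
        have "lkp u i = 0" if "i \<noteq> P" "i \<noteq> N" for i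
          using u0[of i] V_zero[OF V(1), of i] that by (cases i P rule: linorder_cases) auto
        then have "pairB u w" using AB(2) 2 True unfolding pairB_def shapeB_def by simp
        then show ?thesis by (simp add: pairT_def)
      qed
    qed
  next
    case AC
    then have "lkp v N \<noteq> 0" using d2 by (auto simp: pairC_def shapeC_def)
    then have "above u w" using AC(1) V by (intro above_topI) (auto simp: above_def)
    then show ?thesis by (simp add: pairT_def)
  next
    case BA
    have "\<exists>i<N. lkp v i \<noteq> 0"
    proof (rule ccontr)
      assume "\<not> ?thesis"
      then have "lkp v N = d" using V_top[OF V(2)] by simp
      then show False using BA(1) d2 by (simp add: pairB_def)
    qed
    then obtain i where "i < N" "lkp v i \<noteq> 0" by blast
    then have "lkp w N = 0" using BA(2) unfolding above_def by (meson leD)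
    moreover have "j \<ge> P" if "lkp u j \<noteq> 0" for j
      using BA(1) that by (auto simp: pairB_def shapeB_def)
    ultimately have "above u w" using V by (intro above_PI)
    then show ?thesis by (simp add: pairT_def)
  next
    \<comment> \<open>The last exponent of \<open>v\<close> would be both 1 and
      \<open>d - 2\<close>, forcing \<open>d = 3\<close>.\<close>
    case BB
    then show ?thesis using d2 d3 by (auto simp: pairB_def shapeB_def)
  next
    case BC
    have "lkp w N = 0" using BC(2) by (auto simp: pairC_def)
    moreover have "j \<ge> P" if "lkp u j \<noteq> 0" for j
      using BC(1) that by (auto simp: pairB_def shapeB_def)
    ultimately have "above u w" using V by (intro above_PI)
    then show ?thesis by (simp add: pairT_def)
  next
    case CA
    then obtain j where j: "shapeC j u" "lkp v P = 1" "lkp v N = 0" "\<And>i. i > j \<Longrightarrow> i \<noteq> P \<Longrightarrow> lkp v i = 0"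
      by (auto simp: pairC_def)
    have "\<exists>i<P. lkp v i \<noteq> 0"
    proof (rule ccontr)
      assume "\<not> ?thesis"
      then show False using V_top[OF V(2)] j(2,3) d2 by simp
    qed
    then obtain i where i: "i < P" "lkp v i \<noteq> 0" by blast
    then have "i \<le> j" using j(4)[of i] by (cases "i > j") auto
    then have wj: "k \<le> j" if "lkp w k \<noteq> 0" for k
      using CA(2) i that unfolding above_def by (meson le_trans)
    have "k \<ge> j" if "lkp u k \<noteq> 0" for k
      using j(1) that by (cases "k = N"; cases "k = j") (auto simp: shapeC_def)
    then have "above u w" using wj unfolding above_def by (meson le_trans)
    then show ?thesis by (simp add: pairT_def)
  next
    case CB
    then show ?thesis by (auto simp: pairB_def pairC_def shapeB_def)
  next
    case CC
    then show ?thesis using d2 by (auto simp: pairC_def shapeC_def)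
  qed
qed

section \<open>The sum of a standard word determines its first letter\<close>

lemma std_word_sorted_wrt:
  assumes "std_word GG l"
  shows "sorted_wrt pairT l"
proof -
  have "successively pairT l"
    using assms by (auto simp: std_word_def intro: successively_mono std_pair_imp_pairT)
  then show ?thesis
    using assms pairT_trans
    by (subst successively_iff_sorted_wrt_strong[symmetric]) (auto simp: std_word_def)
qed

text \<open>Serves to show that after a letter of shape B only one letter contains the last
  variable. An \<open>above\<close> pair would make \<open>x\<close> a \<open>d\<close>-th power of
  that variable, and \<open>pairB\<close> would give \<open>d = 3\<close>. The next lemma does the
  same for shape C and the variable at \<open>P\<close>.\<close>

lemma pairT_topN:
  assumes "pairT x y" "x \<in> VV" "lkp x N = 1" "lkp y N = 1"
  shows False
proof -
  consider "above x y" | "pairB x y" | "pairC x y" using assms(1) by (auto simp: pairT_def)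
  then show False
  proof cases
    case 1
    then have "N \<le> i" if "lkp x i \<noteq> 0" for i using assms(4) that by (auto simp: above_def)
    then have "lkp x i = 0" if "i < N" for i using that by (meson leD)
    then have "lkp x N = d" using V_top[OF assms(2)] by simp
    then show False using assms(3) d2 by simp
  qed (use assms d2 d3 in \<open>auto simp: pairB_def pairC_def shapeB_def\<close>)
qed

lemma pairT_topP:
  assumes "pairT x y" "x \<in> VV" "lkp x P = 1" "lkp x N = 0" "lkp y P = 1"
  shows False
proof -
  consider "above x y" | "pairB x y" | "pairC x y" using assms(1) by (auto simp: pairT_def)
  then show False
  proof cases
    case 1
    then have "P \<le> i" if "lkp x i \<noteq> 0" for i using assms(5) that by (auto simp: above_def)
    then have "lkp x i = 0" if "i < P" for i using that by (meson leD)
    then have "lkp x P + lkp x N = d" using V_top[OF assms(2)] by simp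
    then show False using assms(3,4) d2 by simp
  qed (use assms d2 in \<open>auto simp: pairB_def pairC_def shapeB_def shapeC_def\<close>)
qed

text \<open>What the sum \<open>s\<close> says about the first letter \<open>u\<close> of a standard
  word: \<open>u\<close> is the greedy letter, or it has one of the two exceptional shapes, told
  apart by the exponent of \<open>s\<close> at \<open>P\<close>.\<close>

definition headT :: "expv \<Rightarrow> expv \<Rightarrow> bool" where
  "headT s u \<longleftrightarrow> (\<exists>r. s = u + r \<and> above u r)
    \<or> (shapeB u \<and> lkp s N = d - 1 \<and> lkp s P \<ge> 2)
    \<or> (\<exists>j. shapeC j u \<and> lkp s N = d - 1 \<and> lkp s P = 1 \<and> lkp s j \<noteq> 0 \<and> (\<forall>i>j. i < P \<longrightarrow> lkp s i = 0))"

text \<open>At the first index \<open>k\<close> where the letters differ, let \<open>u\<close> have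
  the smaller exponent. Equal degrees give a later index \<open>l\<close> where \<open>u\<close> has
  the larger one. Then \<open>r'\<close> contains \<open>l\<close>, beyond the index
  \<open>k\<close> of \<open>u'\<close>, against \<open>above u' r'\<close>.\<close>

lemma above_unique:
  assumes "u \<in> VV" "u' \<in> VV" "u + r = u' + r'" "above u r" "above u' r'"
  shows "u = u'"
proof -
  have "\<not> u < u'" if uu: "u \<in> VV" "u' \<in> VV" "u + r = u' + r'" "above u' r'" for u u' r r'
  proof
    assume "u < u'"
    then obtain k where k: "\<forall>i<k. lkp u i = lkp u' i" "lkp u k < lkp u' k"
      unfolding expv_less_iff by auto
    have kN: "k \<le> N" using V_le[OF uu(2)] k(2) by auto
    have tot: "(\<Sum>i<Suc (Suc P). lkp x i) = d" if "x \<in> VV" for x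
      using V_sum[OF that] by simp
    have "\<exists>l. lkp u' l < lkp u l"
    proof (rule ccontr)
      assume no: "\<not> ?thesis"
      have "(\<Sum>i<Suc (Suc P). lkp u i) < (\<Sum>i<Suc (Suc P). lkp u' i)"
        using no k(2) kN by (intro sum_strict_mono_ex1) (auto simp: not_less intro: bexI[of _ k])
      then show False using tot uu by simp
    qed
    then obtain l where l: "lkp u' l < lkp u l" by blast
    have "lkp u l + lkp r l = lkp u' l + lkp r' l"
      using uu(3) by (metis lookup_add)
    then have "lkp r' l \<noteq> 0" using l by simp
    then have "l \<le> k" using uu(4) k(2) by (auto simp: above_def)
    then show False using k l by (cases "l = k") auto
  qed
  from this[of u u' r r'] this[of u' u r' r] show ?thesis using assms by auto
qed

text \<open>In the exceptional case the removed vector itself is the greedy letter; by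
  \<open>above_unique\<close>, no letter of \<open>GG\<close> is then greedy.\<close>

lemma avec_above:
  assumes "\<forall>i>N. lkp s i = 0" "lkp s N = d - 1" "lkp s P \<noteq> 0"
  shows "\<exists>r. s = a + r \<and> above a r"
proof (intro exI conjI)
  show "s = a + (s - a)"
    by (rule poly_mapping_eqI) (use assms in \<open>auto simp: lookup_add lookup_minus lookup_avec\<close>)
  show "above a (s - a)"
    unfolding above_def
  proof (intro allI impI)
    fix i j assume "lkp a i \<noteq> 0" "lkp (s - a) j \<noteq> 0"
    then have "i \<ge> P" "\<not> j > N" "j \<noteq> N"
      using assms by (auto simp: lookup_avec lookup_minus split: if_splits)
    then show "j \<le> i" by simp
  qed
qed

text \<open>If \<open>a\<close> is the greedy letter, the exponent of \<open>s\<close> at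
  \<open>P\<close> selects the shape, and for shape C the index \<open>j\<close> is the largest one
  below \<open>P\<close> occurring in \<open>s\<close>. Otherwise \<open>u\<close> and
  \<open>u'\<close> are both greedy.\<close>

lemma headT_unique:
  assumes u: "u \<in> GG" "headT s u" and u': "u' \<in> GG" "headT s u'" and s: "\<forall>i>N. lkp s i = 0"
  shows "u = u'"
proof -
  have special: "False" if x: "x \<in> GG" "s = x + r" "above x r" and sp: "lkp s N = d - 1" "lkp s P \<noteq> 0" for x r
  proof -
    obtain q where "s = a + q" "above a q" using avec_above[OF s sp] by blast
    then have "x = a" using above_unique[of x a r q] x avec_V by (auto simp: Gamma_iff)
    then show False using x(1) by (simp add: Gamma_iff)
  qed
  have V: "u \<in> VV" "u' \<in> VV" using u u' by (auto simp: Gamma_iff)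
  show ?thesis
  proof (cases "lkp s N = d - 1 \<and> lkp s P \<noteq> 0")
    case True
    then have no: "\<not> (\<exists>r. s = x + r \<and> above x r)" if "x \<in> GG" for x using special that by blast
    have h: "(shapeB x \<and> lkp s P \<ge> 2) \<or>
        (\<exists>j. shapeC j x \<and> lkp s P = 1 \<and> lkp s j \<noteq> 0 \<and> (\<forall>i>j. i < P \<longrightarrow> lkp s i = 0))"
      if "x \<in> GG" "headT s x" for x
      using that no unfolding headT_def by blast
    show ?thesis
    proof (cases "lkp s P \<ge> 2")
      case True
      then have "shapeB u" "shapeB u'" using h[OF u] h[OF u'] by auto
      then show ?thesis using V by (intro V_eqI) (auto simp: shapeB_def)
    next
      case False
      obtain j where j: "shapeC j u" "lkp s j \<noteq> 0" "\<forall>i>j. i < P \<longrightarrow> lkp s i = 0"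
        using h[OF u] False by auto
      obtain j' where j': "shapeC j' u'" "lkp s j' \<noteq> 0" "\<forall>i>j'. i < P \<longrightarrow> lkp s i = 0"
        using h[OF u'] False by auto
      have "j < P" "j' < P" using j j' by (auto simp: shapeC_def)
      then have "j = j'" using j j' by (metis linorder_neqE_nat)
      then have "lkp u i = lkp u' i" for i
        using j(1) j'(1) by (cases "i = j"; cases "i = N") (auto simp: shapeC_def)
      then show ?thesis by (intro poly_mapping_eqI)
    qed
  next
    case False
    have g: "\<exists>r. s = x + r \<and> above x r" if "headT s x" for x
      using that False unfolding headT_def by fastforce
    then show ?thesis using g[OF u(2)] g[OF u'(2)] above_unique[OF V] by metis
  qed
qed

lemma sum_list_lookup_zero: "(\<And>x. x \<in> set l \<Longrightarrow> lkp x i = 0) \<Longrightarrow> lkp (sum_list l) i = 0"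
  by (induction l) (auto simp: lookup_add)

text \<open>If some later letter \<open>v\<close> violates \<open>above u v\<close>, then
  \<open>u\<close> has an exceptional shape. Comparing every other letter with both \<open>u\<close>
  and \<open>v\<close>, as \<open>sorted_wrt\<close> permits, shows that it contributes nothing at
  the decisive coordinates.\<close>

lemma headT_Cons:
  assumes l: "set (u # l) \<subseteq> GG" and sorted: "sorted_wrt pairT (u # l)"
  shows "headT (sum_list (u # l)) u"
proof (cases "\<forall>v\<in>set l. above u v")
  case True
  then have "above u (sum_list l)" by (intro above_sum_list) auto
  then show ?thesis unfolding headT_def by auto
next
  case False
  then obtain v where v: "v \<in> set l" "\<not> above u v" by blast
  then obtain xs ys where l_eq: "l = xs @ v # ys" by (meson split_list)
  have T: "pairT u x" if "x \<in> set l" for x using sorted that by simp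
  have Tv: "pairT x v \<or> pairT v x" if "x \<in> set xs \<union> set ys" for x
    using sorted that by (auto simp: l_eq sorted_wrt_append)
  have VV: "x \<in> VV" if "x \<in> set l" for x using l that by (auto simp: Gamma_iff)
  have sum: "lkp (sum_list (u # l)) i = lkp u i + lkp v i"
    if "\<And>x. x \<in> set xs \<union> set ys \<Longrightarrow> lkp x i = 0" for i
    using that sum_list_lookup_zero[of xs i] sum_list_lookup_zero[of ys i]
    by (simp add: l_eq lookup_add)
  consider "pairB u v" | "pairC u v" using T[OF v(1)] v(2) by (auto simp: pairT_def)
  then show ?thesis
  proof cases
    case 1
    then have B: "shapeB u" "lkp v N = 1" by (auto simp: pairB_def)
    have "lkp x N = 0" if x: "x \<in> set xs \<union> set ys" for x
    proof -
      have xl: "x \<in> set l" using x by (auto simp: l_eq)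
      consider "above u x" | "pairB u x" | "pairC u x" using T[OF xl] by (auto simp: pairT_def)
      then show ?thesis
      proof cases
        case 1
        have "lkp u P \<noteq> 0" using B by (simp add: shapeB_def)
        then show ?thesis using 1 unfolding above_def by (metis Suc_n_not_le_n)
      next
        case 2
        then have "lkp x N = 1" by (simp add: pairB_def)
        then show ?thesis
          using Tv[OF x] pairT_topN[of x v] pairT_topN[of v x] VV[OF xl] VV[OF v(1)] B by auto
      next
        case 3
        then show ?thesis using B by (auto simp: pairC_def shapeC_def shapeB_def)
      qed
    qed
    then have "lkp (sum_list (u # l)) N = d - 1"
      using sum[of N] B d2 by (simp add: shapeB_def)
    moreover have "lkp (sum_list (u # l)) P \<ge> 2"
      using B by (simp add: shapeB_def lookup_add)
    ultimately show ?thesis using B unfolding headT_def by blast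
  next
    case 2
    then obtain j where j: "shapeC j u" "lkp v P = 1" "lkp v N = 0" "\<And>i. i > j \<Longrightarrow> i \<noteq> P \<Longrightarrow> lkp v i = 0"
      by (auto simp: pairC_def)
    have jP: "j < P" "lkp u j = 1" using j(1) by (auto simp: shapeC_def)
    have x0: "lkp x i = 0" if x: "x \<in> set xs \<union> set ys" and i: "i > j" for x i
    proof -
      have xl: "x \<in> set l" using x by (auto simp: l_eq)
      consider "above u x" | "pairB u x" | "pairC u x" using T[OF xl] by (auto simp: pairT_def)
      then show ?thesis
      proof cases
        case 1
        show ?thesis
        proof (rule ccontr)
          assume "lkp x i \<noteq> 0"
          then have "i \<le> j" using 1 jP(2) unfolding above_def by (metis zero_neq_one)
          then show False using i by simp
        qed
      next
        case 2
        then show ?thesis using j by (auto simp: pairB_def shapeC_def shapeB_def)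
      next
        case 3
        then have "lkp x P = 1" "lkp x N = 0" by (auto simp: pairC_def)
        then show ?thesis
          using Tv[OF x] pairT_topP[of x v] pairT_topP[of v x] VV[OF xl] VV[OF v(1)] j by auto
      qed
    qed
    have "lkp (sum_list (u # l)) N = d - 1"
      using sum[of N] x0[of _ N] j jP by (simp add: shapeC_def)
    moreover have "lkp (sum_list (u # l)) P = 1"
      using sum[of P] x0[of _ P] j jP by (simp add: shapeC_def)
    moreover have "lkp (sum_list (u # l)) j \<noteq> 0"
      using jP by (simp add: lookup_add)
    moreover have "lkp (sum_list (u # l)) i = 0" if "i > j" "i < P" for i
      using sum[of i] x0[of _ i] j that by (simp add: shapeC_def)
    ultimately show ?thesis using j(1) unfolding headT_def by blast
  qed
qed

lemma word_length:
  assumes "set l \<subseteq> GG"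
  shows "(\<Sum>i<Suc (Suc P). lkp (sum_list l) i) = d * length l"
  using assms
proof (induction l)
  case (Cons u l)
  have "(\<Sum>i<Suc (Suc P). lkp u i) = d" using Cons.prems V_sum[of u] by (simp add: Gamma_iff)
  then show ?case using Cons by (simp only: sum_list.Cons lookup_add sum.distrib) simp
qed simp

lemma word_length_eq:
  assumes "set l \<subseteq> GG" "set l' \<subseteq> GG" "sum_list l = sum_list l'"
  shows "length l = length l'"
  using word_length[OF assms(1)] word_length[OF assms(2)] assms(3) d2 by simp

lemma pinched_std_word_unique:
  assumes "std_word GG l" "std_word GG l'" "sum_list l = sum_list l'"
  shows "l = l'"
  using assms
proof (induction l arbitrary: l')
  case Nil
  then show ?case using word_length_eq[of "[]" l'] by (simp add: std_word_def)
next
  case (Cons u l)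
  have G: "set (u # l) \<subseteq> GG" "set l' \<subseteq> GG" using Cons.prems by (auto simp: std_word_def)
  then obtain u' k where l': "l' = u' # k"
    using word_length_eq[OF G Cons.prems(3)] by (cases l') auto
  let ?s = "sum_list (u # l)"
  have "headT ?s u"
    using headT_Cons[OF G(1) std_word_sorted_wrt[OF Cons.prems(1)]] .
  moreover have "headT ?s u'"
    using headT_Cons[of u' k] G(2) std_word_sorted_wrt[OF Cons.prems(2)] Cons.prems(3) l' by simp
  moreover have "\<forall>i>N. lkp ?s i = 0"
    using G(1) V_zero by (intro allI impI sum_list_lookup_zero) (auto simp: Gamma_iff)
  ultimately have u: "u = u'"
    using G l' by (intro headT_unique[of u ?s u']) auto
  have "std_word GG l" "std_word GG k"
    using Cons.prems(1,2) l' by (auto simp: std_word_def successively_Cons)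
  moreover have "sum_list l = sum_list k" using Cons.prems(3) l' u by simp
  ultimately have "l = k" by (rule Cons.IH)
  then show ?case using l' u by simp
qed

lemma finite_Gamma: "finite GG"
proof (rule finite_imageD)
  let ?f = "\<lambda>u. map (lkp u) [0..<Suc (Suc P)]"
  have "lkp u i \<le> d" if "u \<in> GG" "i < Suc (Suc P)" for u i
  proof -
    have "lkp u i \<le> (\<Sum>i<Suc (Suc P). lkp u i)"
      using that(2) by (intro member_le_sum) auto
    then show ?thesis using V_sum[of u] that(1) by (simp add: Gamma_iff)
  qed
  then have "?f ` GG \<subseteq> {xs. set xs \<subseteq> {..d} \<and> length xs = Suc (Suc P)}"
    by (auto simp del: upt_Suc)
  then show "finite (?f ` GG)"
    by (rule finite_subset[OF _ finite_lists_length_eq]) simp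
  show "inj_on ?f GG"
  proof (rule inj_onI)
    fix u v assume uv: "u \<in> GG" "v \<in> GG" "?f u = ?f v"
    then have "lkp u i = lkp v i" if "i < Suc (Suc P)" for i
      using that by (simp add: map_eq_conv less_Suc_eq del: upt_Suc)
    then show "u = v" using uv by (intro V_eqI) (auto simp: Gamma_iff)
  qed
qed

sublocale pbw_set GG
proof unfold_locales
  show "finite GG" by (rule finite_Gamma)
  show "length l = length l'" if "set l \<subseteq> GG" "set l' \<subseteq> GG" "sum_list l = sum_list l'" for l l'
    using that by (rule word_length_eq)
  show "l = l'" if "std_word GG l" "std_word GG l'" "sum_list l = sum_list l'" for l l'
    using that by (rule pinched_std_word_unique)
qed

end

section \<open>Minimal chains of length two and standard pairs\<close>

lemma adeg_eq_0_iff: "adeg x c = 0 \<longleftrightarrow> x \<notin> set c"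
  by (auto simp: adeg_def filter_empty_conv)

text \<open>The pair has \<open>adeg\<close> 0, so a smaller chain must avoid the removed vector and
  be lexicographically smaller; with equal sums the first letters decide.\<close>

lemma minimal_chain_iff_std_pair:
  assumes "\<alpha> \<in> Gamma n d" "\<beta> \<in> Gamma n d"
  shows "minimal_chain n d [\<alpha>, \<beta>] \<longleftrightarrow> std_pair (Gamma n d) \<alpha> \<beta>"
proof -
  let ?a = "avec n d"
  have V: "\<alpha> \<in> V n d" "\<beta> \<in> V n d" and ad: "adeg ?a [\<alpha>, \<beta>] = 0"
    using assms by (auto simp: Gamma_def adeg_eq_0_iff)
  have less: "chain_less ?a [\<gamma>, \<delta>] [\<alpha>, \<beta>] \<longleftrightarrow> \<gamma> \<noteq> ?a \<and> \<delta> \<noteq> ?a \<and> \<gamma> < \<alpha>"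
    if "\<gamma> + \<delta> = \<alpha> + \<beta>" for \<gamma> \<delta>
  proof -
    have "(\<exists>k<Suc (Suc 0). Q k) \<longleftrightarrow> Q 0 \<or> Q (Suc 0)" for Q
      by (auto simp: less_Suc_eq)
    then have "tuple_lex_less [\<gamma>, \<delta>] [\<alpha>, \<beta>] \<longleftrightarrow> \<gamma> < \<alpha> \<or> (\<gamma> = \<alpha> \<and> \<delta> < \<beta>)"
      by (simp add: tuple_lex_less_def lex_less_iff)
    also have "\<dots> \<longleftrightarrow> \<gamma> < \<alpha>" using that by auto
    finally show ?thesis
      using ad adeg_eq_0_iff[of ?a "[\<gamma>, \<delta>]"] by (auto simp: chain_less_def)
  qed
  have "(\<exists>c'. length c' = length [\<alpha>, \<beta>] \<and> set c' \<subseteq> V n d \<and> sum_list c' = sum_list [\<alpha>, \<beta>] \<and>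
      chain_less ?a c' [\<alpha>, \<beta>]) \<longleftrightarrow>
    (\<exists>\<gamma> \<delta>. \<gamma> \<in> V n d \<and> \<delta> \<in> V n d \<and> \<gamma> + \<delta> = \<alpha> + \<beta> \<and> chain_less ?a [\<gamma>, \<delta>] [\<alpha>, \<beta>])"
    (is "?L \<longleftrightarrow> ?R")
  proof
    assume ?L
    then obtain c' where c': "length c' = Suc (Suc 0)" "set c' \<subseteq> V n d" "sum_list c' = \<alpha> + \<beta>"
      "chain_less ?a c' [\<alpha>, \<beta>]" by auto
    then obtain \<gamma> \<delta> where "c' = [\<gamma>, \<delta>]" by (auto simp: length_Suc_conv)
    with c' show ?R by (intro exI[of _ \<gamma>] exI[of _ \<delta>]) simp
  next
    assume ?R
    then obtain \<gamma> \<delta> where "\<gamma> \<in> V n d" "\<delta> \<in> V n d" "\<gamma> + \<delta> = \<alpha> + \<beta>" "chain_less ?a [\<gamma>, \<delta>] [\<alpha>, \<beta>]"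
      by blast
    then show ?L by (intro exI[of _ "[\<gamma>, \<delta>]"]) simp
  qed
  then have "minimal_chain n d [\<alpha>, \<beta>] \<longleftrightarrow>
    \<not> (\<exists>\<gamma> \<delta>. \<gamma> \<in> V n d \<and> \<delta> \<in> V n d \<and> \<gamma> + \<delta> = \<alpha> + \<beta> \<and> chain_less ?a [\<gamma>, \<delta>] [\<alpha>, \<beta>])"
    unfolding minimal_chain_def using V by simp
  also have "\<dots> \<longleftrightarrow> std_pair (Gamma n d) \<alpha> \<beta>"
    using assms less by (auto simp: std_pair_def Gamma_def not_less[symmetric])
  finally show ?thesis .
qed

text \<open>The pair \<open>[\<alpha>, \<beta>]\<close> is itself a competitor with
  \<open>adeg\<close> 0, so the minimal chain cannot contain the removed vector.\<close>

lemma minimal_chain_in_Gamma: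
  assumes "\<alpha> \<in> Gamma n d" "\<beta> \<in> Gamma n d" "minimal_chain n d [\<gamma>, \<delta>]" "\<gamma> + \<delta> = \<alpha> + \<beta>"
  shows "\<gamma> \<in> Gamma n d" "\<delta> \<in> Gamma n d"
proof -
  let ?a = "avec n d"
  have V: "\<gamma> \<in> V n d" "\<delta> \<in> V n d" using assms(3) by (auto simp: minimal_chain_def)
  have "set [\<alpha>, \<beta>] \<subseteq> V n d" "adeg ?a [\<alpha>, \<beta>] = 0"
    using assms by (auto simp: Gamma_def adeg_eq_0_iff)
  moreover have "\<not> chain_less ?a [\<alpha>, \<beta>] [\<gamma>, \<delta>]"
    using assms(3,4) calculation(1) unfolding minimal_chain_def by force
  ultimately have "adeg ?a [\<gamma>, \<delta>] = 0" by (simp add: chain_less_def)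
  then show "\<gamma> \<in> Gamma n d" "\<delta> \<in> Gamma n d" using V by (auto simp: Gamma_def adeg_eq_0_iff)
qed

theorem theorem2p7:
  fixes n d :: nat
  assumes "n \<ge> 2" and "d \<ge> 2" and "d \<noteq> 3"
  shows "groebner_basis (Gamma n d)
           {var \<alpha> * var \<beta> - var \<gamma> * var \<delta> | \<alpha> \<beta> \<gamma> \<delta>.
              \<alpha> \<in> Gamma n d \<and> \<beta> \<in> Gamma n d \<and> lex_le \<alpha> \<beta> \<and>
              \<not> minimal_chain n d [\<alpha>, \<beta>] \<and>
              minimal_chain n d [\<gamma>, \<delta>] \<and> \<gamma> + \<delta> = \<alpha> + \<beta>}
           (toric_ideal (Gamma n d) :: 'k::field spoly set)
       \<and> koszul (Gamma n d) TYPE('k)"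
  proof -
  obtain P where n: "n = Suc (Suc P)"
    using assms(1) that[of "n - 2"] by simp
  interpret pinched P d
    using assms by unfold_locales
  let ?G = "Gamma n d"
  \<comment> \<open>Membership of \<open>\<gamma>\<close> and \<open>\<delta>\<close> in
    \<open>?G\<close> is implicit on the left and part of \<open>std_pair\<close> on the right;
    \<open>minimal_chain_in_Gamma\<close> bridges the two.\<close>
  have "\<alpha> \<in> ?G \<and> \<beta> \<in> ?G \<and> lex_le \<alpha> \<beta> \<and> \<not> minimal_chain n d [\<alpha>, \<beta>] \<and>
      minimal_chain n d [\<gamma>, \<delta>] \<and> \<gamma> + \<delta> = \<alpha> + \<beta> \<longleftrightarrow>
    \<alpha> \<in> ?G \<and> \<beta> \<in> ?G \<and> \<alpha> \<le> \<beta> \<and> \<not> std_pair ?G \<alpha> \<beta> \<and> std_pair ?G \<gamma> \<delta> \<and> \<gamma> + \<delta> = \<alpha> + \<beta>"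
    for \<alpha> \<beta> \<gamma> \<delta>
    using minimal_chain_iff_std_pair[of \<alpha> n d \<beta>] minimal_chain_iff_std_pair[of \<gamma> n d \<delta>]
      minimal_chain_in_Gamma[of \<alpha> n d \<beta> \<gamma> \<delta>] std_pair_def[of ?G \<gamma> \<delta>]
    unfolding lex_le_iff by blast
  then show ?thesis
    using groebner[where 'k = 'k] koszul[where 'k = 'k]
    unfolding straightenings_def by (simp only: n)
qed

end
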